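(* Let $\mathsf{S}$ be a pseudo-tensor category over a field $\mathbf{k}$ with grading shift functor $X\mapsto X\langle i\rangle$ and with a set $\mathbb{W}$ and family $\{B_x\mid x\in\mathbb{W}\}$ of indecomposable objects satisfying conditions (i) and (ii) of the context. Assume additionally that $X^{\ast\ast}\simeq X$ for every $X\in\mathsf{S}$ and that there is a monoidal equivalence $I:\mathsf{S}\to\mathsf{S}^{\mathrm{op}}$, $X\mapsto\overline{X}$, with $\overline{B_x}=B_x$ for all $x\in\mathbb{W}$ and $\overline{X\langle1\rangle}=\overline{X}\langle-1\rangle$, where $\mathsf{S}^{\mathrm{op}}$ is the category with morphisms (but not the tensor product) reversed. Then each element $d\in\mathcal{D}$ satisfies $d=d^{-1}$ (property P6).
   Context: A pseudo-tensor category over $\mathbf{k}$ is an essentially small $\mathbf{k}$-linear monoidal category $(\mathsf{S},\otimes,\mathbf{1})$ that is additive, idempotent complete, has finite-dimensional morphism spaces, satisfies $\mathbf{k}\xrightarrow{\sim}\mathrm{End}(\mathbf{1})$, and in which every object $X$ has a left dual $X^\ast$ and a right dual ${}^\ast X$. Grading shift functor: an auto-equivalence $F:\mathsf{S}\to\mathsf{S}$ of $\mathsf{S}$ as a bimodule category over itself; write $X\langle i\rangle=F^i(X)$, $i\in\mathbb{Z}$. Conditions: (i) $\{B_x\mid x\in\mathbb{W}\}$ is a family of indecomposable objects closed (up to isomorphism) under taking duals, such that for every indecomposable $X\in\mathsf{S}$ there is precisely one pair $(x,i)\in\mathbb{W}\times\mathbb{Z}$ with $X\simeq B_x\langle i\rangle$;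 (ii) for all $x,y\in\mathbb{W}$ and $i\le0$, $\dim_{\mathbf{k}}\mathrm{Hom}(B_x,B_y\langle i\rangle)=\delta_{x,y}\delta_{i,0}$. For $x\in\mathbb{W}$, $x^{\ast}\in\mathbb{W}$ is defined by $B_x^\ast\simeq B_{x^\ast}$ and ${}^\ast x$ by ${}^\ast B_x\simeq B_{{}^\ast x}$; under the assumption $X^{\ast\ast}\simeq X$ these agree, and one writes $x^{-1}:=x^\ast={}^\ast x$. Define $\mathsf{a}(x)=\sup\{i\in\mathbb{Z}\mid B_x\langle i\rangle\text{ is a direct summand of }B_y\otimes B_z\text{ for some }y,z\in\mathbb{W}\}\in\mathbb{Z}\cup\{\infty\}$, $\Delta(x)=\min\{i\in\mathbb{N}\mid\mathrm{Hom}(\mathbf{1},B_x\langle i\rangle)\neq0\}\in\mathbb{N}\cup\{\infty\}$ (with $\min\varnothing=\infty$), and $\mathcal{D}=\{x\in\mathbb{W}\mid\mathsf{a}(x)=\Delta(x)<\infty\}$. *)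

theory Defs
  imports Complex_Main "HOL-Library.Extended_Real"
begin

section \<open>Monoidal categories\<close>

text \<open>
  All morphisms live in one type, and composition and tensor product of morphisms
  do not carry object indices. For a \<open>k\<close>-linear category one takes for \<open>'m\<close> the direct sum
  of all the spaces \<open>Hom(X,Y)\<close>; composition, tensor product and functors are unambiguous, since
  a nonzero element of a hom-space determines source and target and all of these operations send zero
  morphisms to zero morphisms. Every hom-space is then a subspace of one vector space,
  so that the library's span and dim apply. Disjointness of hom-spaces (up to \<open>0\<close>) is
  not needed and not required. Essential smallness is automatic, because the objects form a set
  of elements of a type.
\<close>

record ('o, 'm) moncat =
  Obj :: "'o set"
  Hom :: "'o \<Rightarrow> 'o \<Rightarrow> 'm set"
  Id :: "'o \<Rightarrow> 'm"
  Comp :: "'m \<Rightarrow> 'm \<Rightarrow> 'm"  (infixr "\<odot>\<index>" 60)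
  TensO :: "'o \<Rightarrow> 'o \<Rightarrow> 'o"  (infixr "\<otimes>\<index>" 70)
  TensM :: "'m \<Rightarrow> 'm \<Rightarrow> 'm"  (infixr "\<boxtimes>\<index>" 70)
  Unit :: "'o"  ("\<one>\<index>")
  Assoc :: "'o \<Rightarrow> 'o \<Rightarrow> 'o \<Rightarrow> 'm"
  LUnit :: "'o \<Rightarrow> 'm"
  RUnit :: "'o \<Rightarrow> 'm"

definition inverse_pair :: "('o, 'm) moncat \<Rightarrow> 'o \<Rightarrow> 'o \<Rightarrow> 'm \<Rightarrow> 'm \<Rightarrow> bool" where
  "inverse_pair C X Y f g \<longleftrightarrow>
     f \<in> Hom C X Y \<and> g \<in> Hom C Y X \<and> g \<odot>\<^bsub>C\<^esub> f = Id C X \<and> f \<odot>\<^bsub>C\<^esub> g = Id C Y"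

definition is_iso :: "('o, 'm) moncat \<Rightarrow> 'o \<Rightarrow> 'o \<Rightarrow> 'm \<Rightarrow> bool" where
  "is_iso C X Y f \<longleftrightarrow> (\<exists>g. inverse_pair C X Y f g)"

definition inv_mor :: "('o, 'm) moncat \<Rightarrow> 'o \<Rightarrow> 'o \<Rightarrow> 'm \<Rightarrow> 'm" where
  "inv_mor C X Y f = (THE g. inverse_pair C X Y f g)"

definition isomorphic :: "('o, 'm) moncat \<Rightarrow> 'o \<Rightarrow> 'o \<Rightarrow> bool" where
  "isomorphic C X Y \<longleftrightarrow> (\<exists>f. is_iso C X Y f)"

locale category =
  fixes C :: "('o, 'm) moncat" (structure)
  assumes Id_in_Hom: "X \<in> Obj C \<Longrightarrow> Id C X \<in> Hom C X X"
    and Comp_in_Hom: "\<lbrakk>X \<in> Obj C; Y \<in> Obj C; Z \<in> Obj C; f \<in> Hom C X Y; g \<in> Hom C Y Z\<rbrakk>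
      \<Longrightarrow> g \<odot> f \<in> Hom C X Z"
    and Comp_Id: "\<lbrakk>X \<in> Obj C; Y \<in> Obj C; f \<in> Hom C X Y\<rbrakk> \<Longrightarrow> f \<odot> Id C X = f"
    and Id_Comp: "\<lbrakk>X \<in> Obj C; Y \<in> Obj C; f \<in> Hom C X Y\<rbrakk> \<Longrightarrow> Id C Y \<odot> f = f"
    and Comp_assoc: "\<lbrakk>X \<in> Obj C; Y \<in> Obj C; Z \<in> Obj C; U \<in> Obj C;
      f \<in> Hom C X Y; g \<in> Hom C Y Z; h \<in> Hom C Z U\<rbrakk> \<Longrightarrow> (h \<odot> g) \<odot> f = h \<odot> (g \<odot> f)"

locale monoidal_category = category +
  assumes Unit_Obj: "\<one> \<in> Obj C"
    and TensO_Obj: "\<lbrakk>X \<in> Obj C; Y \<in> Obj C\<rbrakk> \<Longrightarrow> X \<otimes> Y \<in> Obj C"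
    and TensM_in_Hom: "\<lbrakk>X \<in> Obj C; X' \<in> Obj C; Y \<in> Obj C; Y' \<in> Obj C;
      f \<in> Hom C X X'; g \<in> Hom C Y Y'\<rbrakk> \<Longrightarrow> f \<boxtimes> g \<in> Hom C (X \<otimes> Y) (X' \<otimes> Y')"
    and TensM_Id: "\<lbrakk>X \<in> Obj C; Y \<in> Obj C\<rbrakk> \<Longrightarrow> Id C X \<boxtimes> Id C Y = Id C (X \<otimes> Y)"
    and interchange: "\<lbrakk>X \<in> Obj C; X' \<in> Obj C; X'' \<in> Obj C; Y \<in> Obj C; Y' \<in> Obj C; Y'' \<in> Obj C;
      f \<in> Hom C X X'; f' \<in> Hom C X' X''; g \<in> Hom C Y Y'; g' \<in> Hom C Y' Y''\<rbrakk>
      \<Longrightarrow> (f' \<odot> f) \<boxtimes> (g' \<odot> g) = (f' \<boxtimes> g') \<odot> (f \<boxtimes> g)"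
    and Assoc_iso: "\<lbrakk>X \<in> Obj C; Y \<in> Obj C; Z \<in> Obj C\<rbrakk>
      \<Longrightarrow> is_iso C ((X \<otimes> Y) \<otimes> Z) (X \<otimes> (Y \<otimes> Z)) (Assoc C X Y Z)"
    and LUnit_iso: "X \<in> Obj C \<Longrightarrow> is_iso C (\<one> \<otimes> X) X (LUnit C X)"
    and RUnit_iso: "X \<in> Obj C \<Longrightarrow> is_iso C (X \<otimes> \<one>) X (RUnit C X)"
    and Assoc_natural: "\<lbrakk>X \<in> Obj C; X' \<in> Obj C; Y \<in> Obj C; Y' \<in> Obj C; Z \<in> Obj C; Z' \<in> Obj C;
      f \<in> Hom C X X'; g \<in> Hom C Y Y'; h \<in> Hom C Z Z'\<rbrakk>
      \<Longrightarrow> Assoc C X' Y' Z' \<odot> ((f \<boxtimes> g) \<boxtimes> h) = (f \<boxtimes> (g \<boxtimes> h)) \<odot> Assoc C X Y Z"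
    and LUnit_natural: "\<lbrakk>X \<in> Obj C; Y \<in> Obj C; f \<in> Hom C X Y\<rbrakk>
      \<Longrightarrow> LUnit C Y \<odot> (Id C \<one> \<boxtimes> f) = f \<odot> LUnit C X"
    and RUnit_natural: "\<lbrakk>X \<in> Obj C; Y \<in> Obj C; f \<in> Hom C X Y\<rbrakk>
      \<Longrightarrow> RUnit C Y \<odot> (f \<boxtimes> Id C \<one>) = f \<odot> RUnit C X"
    and pentagon: "\<lbrakk>X \<in> Obj C; Y \<in> Obj C; Z \<in> Obj C; U \<in> Obj C\<rbrakk>
      \<Longrightarrow> (Id C X \<boxtimes> Assoc C Y Z U) \<odot> Assoc C X (Y \<otimes> Z) U \<odot> (Assoc C X Y Z \<boxtimes> Id C U)
        = Assoc C X Y (Z \<otimes> U) \<odot> Assoc C (X \<otimes> Y) Z U"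
    and triangle: "\<lbrakk>X \<in> Obj C; Y \<in> Obj C\<rbrakk>
      \<Longrightarrow> (Id C X \<boxtimes> LUnit C Y) \<odot> Assoc C X \<one> Y = RUnit C X \<boxtimes> Id C Y"

text \<open>Morphisms are reversed, the tensor product is not.\<close>

definition opposite :: "('o, 'm) moncat \<Rightarrow> ('o, 'm) moncat" where
  "opposite C =
     \<lparr>Obj = Obj C,
      Hom = (\<lambda>X Y. Hom C Y X),
      Id = Id C,
      Comp = (\<lambda>g f. f \<odot>\<^bsub>C\<^esub> g),
      TensO = TensO C,
      TensM = TensM C,
      Unit = Unit C,
      Assoc = (\<lambda>X Y Z. inv_mor C ((X \<otimes>\<^bsub>C\<^esub> Y) \<otimes>\<^bsub>C\<^esub> Z) (X \<otimes>\<^bsub>C\<^esub> (Y \<otimes>\<^bsub>C\<^esub> Z)) (Assoc C X Y Z)),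
      LUnit = (\<lambda>X. inv_mor C (\<one>\<^bsub>C\<^esub> \<otimes>\<^bsub>C\<^esub> X) X (LUnit C X)),
      RUnit = (\<lambda>X. inv_mor C (X \<otimes>\<^bsub>C\<^esub> \<one>\<^bsub>C\<^esub>) X (RUnit C X))\<rparr>"


section \<open>Functors\<close>

text \<open>A functor is given by its object map and its morphism map.\<close>

definition is_functor ::
  "('o, 'm) moncat \<Rightarrow> ('p, 'n) moncat \<Rightarrow> ('o \<Rightarrow> 'p) \<Rightarrow> ('m \<Rightarrow> 'n) \<Rightarrow> bool" where
  "is_functor C D Fo Fm \<longleftrightarrow>
     (\<forall>X\<in>Obj C. Fo X \<in> Obj D) \<and>
     (\<forall>X\<in>Obj C. \<forall>Y\<in>Obj C. \<forall>f\<in>Hom C X Y. Fm f \<in> Hom D (Fo X) (Fo Y)) \<and>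
     (\<forall>X\<in>Obj C. Fm (Id C X) = Id D (Fo X)) \<and>
     (\<forall>X\<in>Obj C. \<forall>Y\<in>Obj C. \<forall>Z\<in>Obj C. \<forall>f\<in>Hom C X Y. \<forall>g\<in>Hom C Y Z.
        Fm (g \<odot>\<^bsub>C\<^esub> f) = Fm g \<odot>\<^bsub>D\<^esub> Fm f)"

definition natural_iso ::
  "('o, 'm) moncat \<Rightarrow> ('p, 'n) moncat \<Rightarrow> ('o \<Rightarrow> 'p) \<Rightarrow> ('m \<Rightarrow> 'n) \<Rightarrow> ('o \<Rightarrow> 'p) \<Rightarrow> ('m \<Rightarrow> 'n)
     \<Rightarrow> ('o \<Rightarrow> 'n) \<Rightarrow> bool" where
  "natural_iso C D Fo Fm Go Gm \<eta> \<longleftrightarrow>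
     (\<forall>X\<in>Obj C. is_iso D (Fo X) (Go X) (\<eta> X)) \<and>
     (\<forall>X\<in>Obj C. \<forall>Y\<in>Obj C. \<forall>f\<in>Hom C X Y. \<eta> Y \<odot>\<^bsub>D\<^esub> Fm f = Gm f \<odot>\<^bsub>D\<^esub> \<eta> X)"

definition quasi_inverse ::
  "('o, 'm) moncat \<Rightarrow> ('p, 'n) moncat \<Rightarrow> ('o \<Rightarrow> 'p) \<Rightarrow> ('m \<Rightarrow> 'n) \<Rightarrow> ('p \<Rightarrow> 'o) \<Rightarrow> ('n \<Rightarrow> 'm)
     \<Rightarrow> bool" where
  "quasi_inverse C D Fo Fm Go Gm \<longleftrightarrow>
     is_functor C D Fo Fm \<and> is_functor D C Go Gm \<and>
     (\<exists>\<eta>. natural_iso C C id id (Go \<circ> Fo) (Gm \<circ> Fm) \<eta>) \<and>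
     (\<exists>\<epsilon>. natural_iso D D (Fo \<circ> Go) (Fm \<circ> Gm) id id \<epsilon>)"

definition is_equivalence ::
  "('o, 'm) moncat \<Rightarrow> ('p, 'n) moncat \<Rightarrow> ('o \<Rightarrow> 'p) \<Rightarrow> ('m \<Rightarrow> 'n) \<Rightarrow> bool" where
  "is_equivalence C D Fo Fm \<longleftrightarrow> (\<exists>Go Gm. quasi_inverse C D Fo Fm Go Gm)"

definition monoidal_structure ::
  "('o, 'm) moncat \<Rightarrow> ('p, 'n) moncat \<Rightarrow> ('o \<Rightarrow> 'p) \<Rightarrow> ('m \<Rightarrow> 'n)
     \<Rightarrow> ('o \<Rightarrow> 'o \<Rightarrow> 'n) \<Rightarrow> 'n \<Rightarrow> bool" where
  "monoidal_structure C D Fo Fm J u \<longleftrightarrow>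
     is_iso D \<one>\<^bsub>D\<^esub> (Fo \<one>\<^bsub>C\<^esub>) u \<and>
     (\<forall>X\<in>Obj C. \<forall>Y\<in>Obj C. is_iso D (Fo X \<otimes>\<^bsub>D\<^esub> Fo Y) (Fo (X \<otimes>\<^bsub>C\<^esub> Y)) (J X Y)) \<and>
     (\<forall>X\<in>Obj C. \<forall>X'\<in>Obj C. \<forall>Y\<in>Obj C. \<forall>Y'\<in>Obj C. \<forall>f\<in>Hom C X X'. \<forall>g\<in>Hom C Y Y'.
        J X' Y' \<odot>\<^bsub>D\<^esub> (Fm f \<boxtimes>\<^bsub>D\<^esub> Fm g) = Fm (f \<boxtimes>\<^bsub>C\<^esub> g) \<odot>\<^bsub>D\<^esub> J X Y) \<and>
     (\<forall>X\<in>Obj C. \<forall>Y\<in>Obj C. \<forall>Z\<in>Obj C.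
        Fm (Assoc C X Y Z) \<odot>\<^bsub>D\<^esub> J (X \<otimes>\<^bsub>C\<^esub> Y) Z \<odot>\<^bsub>D\<^esub> (J X Y \<boxtimes>\<^bsub>D\<^esub> Id D (Fo Z))
        = J X (Y \<otimes>\<^bsub>C\<^esub> Z) \<odot>\<^bsub>D\<^esub> (Id D (Fo X) \<boxtimes>\<^bsub>D\<^esub> J Y Z) \<odot>\<^bsub>D\<^esub> Assoc D (Fo X) (Fo Y) (Fo Z)) \<and>
     (\<forall>X\<in>Obj C.
        Fm (LUnit C X) \<odot>\<^bsub>D\<^esub> J \<one>\<^bsub>C\<^esub> X \<odot>\<^bsub>D\<^esub> (u \<boxtimes>\<^bsub>D\<^esub> Id D (Fo X)) = LUnit D (Fo X)) \<and>
     (\<forall>X\<in>Obj C.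
        Fm (RUnit C X) \<odot>\<^bsub>D\<^esub> J X \<one>\<^bsub>C\<^esub> \<odot>\<^bsub>D\<^esub> (Id D (Fo X) \<boxtimes>\<^bsub>D\<^esub> u) = RUnit D (Fo X))"

definition monoidal_equivalence ::
  "('o, 'm) moncat \<Rightarrow> ('p, 'n) moncat \<Rightarrow> ('o \<Rightarrow> 'p) \<Rightarrow> ('m \<Rightarrow> 'n) \<Rightarrow> bool" where
  "monoidal_equivalence C D Fo Fm \<longleftrightarrow>
     is_equivalence C D Fo Fm \<and> (\<exists>J u. monoidal_structure C D Fo Fm J u)"


section \<open>Grading shifts\<close>

text \<open>
  Coherence data \<open>s X M : F (X \<otimes> M) \<rightarrow> X \<otimes> F M\<close> and \<open>t M X : F (M \<otimes> X) \<rightarrow> F M \<otimes> X\<close> making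
  \<open>F\<close> a functor of left modules, of right modules, and of bimodules, where \<open>C\<close> is the regular
  bimodule category over itself.
\<close>

definition left_module_structure ::
  "('o, 'm) moncat \<Rightarrow> ('o \<Rightarrow> 'o) \<Rightarrow> ('m \<Rightarrow> 'm) \<Rightarrow> ('o \<Rightarrow> 'o \<Rightarrow> 'm) \<Rightarrow> bool" where
  "left_module_structure C Fo Fm s \<longleftrightarrow>
     (\<forall>X\<in>Obj C. \<forall>M\<in>Obj C. is_iso C (Fo (X \<otimes>\<^bsub>C\<^esub> M)) (X \<otimes>\<^bsub>C\<^esub> Fo M) (s X M)) \<and>
     (\<forall>X\<in>Obj C. \<forall>X'\<in>Obj C. \<forall>M\<in>Obj C. \<forall>M'\<in>Obj C. \<forall>f\<in>Hom C X X'. \<forall>g\<in>Hom C M M'.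
        s X' M' \<odot>\<^bsub>C\<^esub> Fm (f \<boxtimes>\<^bsub>C\<^esub> g) = (f \<boxtimes>\<^bsub>C\<^esub> Fm g) \<odot>\<^bsub>C\<^esub> s X M) \<and>
     (\<forall>X\<in>Obj C. \<forall>Y\<in>Obj C. \<forall>M\<in>Obj C.
        (Id C X \<boxtimes>\<^bsub>C\<^esub> s Y M) \<odot>\<^bsub>C\<^esub> s X (Y \<otimes>\<^bsub>C\<^esub> M) \<odot>\<^bsub>C\<^esub> Fm (Assoc C X Y M)
        = Assoc C X Y (Fo M) \<odot>\<^bsub>C\<^esub> s (X \<otimes>\<^bsub>C\<^esub> Y) M) \<and>
     (\<forall>M\<in>Obj C. LUnit C (Fo M) \<odot>\<^bsub>C\<^esub> s \<one>\<^bsub>C\<^esub> M = Fm (LUnit C M))"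

definition right_module_structure ::
  "('o, 'm) moncat \<Rightarrow> ('o \<Rightarrow> 'o) \<Rightarrow> ('m \<Rightarrow> 'm) \<Rightarrow> ('o \<Rightarrow> 'o \<Rightarrow> 'm) \<Rightarrow> bool" where
  "right_module_structure C Fo Fm t \<longleftrightarrow>
     (\<forall>M\<in>Obj C. \<forall>X\<in>Obj C. is_iso C (Fo (M \<otimes>\<^bsub>C\<^esub> X)) (Fo M \<otimes>\<^bsub>C\<^esub> X) (t M X)) \<and>
     (\<forall>M\<in>Obj C. \<forall>M'\<in>Obj C. \<forall>X\<in>Obj C. \<forall>X'\<in>Obj C. \<forall>g\<in>Hom C M M'. \<forall>f\<in>Hom C X X'.
        t M' X' \<odot>\<^bsub>C\<^esub> Fm (g \<boxtimes>\<^bsub>C\<^esub> f) = (Fm g \<boxtimes>\<^bsub>C\<^esub> f) \<odot>\<^bsub>C\<^esub> t M X) \<and>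
     (\<forall>M\<in>Obj C. \<forall>X\<in>Obj C. \<forall>Y\<in>Obj C.
        Assoc C (Fo M) X Y \<odot>\<^bsub>C\<^esub> (t M X \<boxtimes>\<^bsub>C\<^esub> Id C Y) \<odot>\<^bsub>C\<^esub> t (M \<otimes>\<^bsub>C\<^esub> X) Y
        = t M (X \<otimes>\<^bsub>C\<^esub> Y) \<odot>\<^bsub>C\<^esub> Fm (Assoc C M X Y)) \<and>
     (\<forall>M\<in>Obj C. RUnit C (Fo M) \<odot>\<^bsub>C\<^esub> t M \<one>\<^bsub>C\<^esub> = Fm (RUnit C M))"

definition bimodule_structure ::
  "('o, 'm) moncat \<Rightarrow> ('o \<Rightarrow> 'o) \<Rightarrow> ('m \<Rightarrow> 'm) \<Rightarrow> ('o \<Rightarrow> 'o \<Rightarrow> 'm) \<Rightarrow> ('o \<Rightarrow> 'o \<Rightarrow> 'm) \<Rightarrow> bool" where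
  "bimodule_structure C Fo Fm s t \<longleftrightarrow>
     left_module_structure C Fo Fm s \<and> right_module_structure C Fo Fm t \<and>
     (\<forall>X\<in>Obj C. \<forall>M\<in>Obj C. \<forall>Y\<in>Obj C.
        Assoc C X (Fo M) Y \<odot>\<^bsub>C\<^esub> (s X M \<boxtimes>\<^bsub>C\<^esub> Id C Y) \<odot>\<^bsub>C\<^esub> t (X \<otimes>\<^bsub>C\<^esub> M) Y
        = (Id C X \<boxtimes>\<^bsub>C\<^esub> t M Y) \<odot>\<^bsub>C\<^esub> s X (M \<otimes>\<^bsub>C\<^esub> Y) \<odot>\<^bsub>C\<^esub> Fm (Assoc C X M Y))"

text \<open>
  The quasi-inverse \<open>G\<close> is part of the data, since it enters \<open>X\<langle>i\<rangle>\<close> for negative \<open>i\<close>.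
  Linearity of \<open>F\<close> need not be demanded: \<open>F\<close> is naturally isomorphic to tensoring with \<open>F \<one>\<close>.
\<close>

definition grading_shift ::
  "('o, 'm) moncat \<Rightarrow> ('o \<Rightarrow> 'o) \<Rightarrow> ('m \<Rightarrow> 'm) \<Rightarrow> ('o \<Rightarrow> 'o) \<Rightarrow> ('m \<Rightarrow> 'm) \<Rightarrow> bool" where
  "grading_shift C Fo Fm Go Gm \<longleftrightarrow>
     quasi_inverse C C Fo Fm Go Gm \<and> (\<exists>s t. bimodule_structure C Fo Fm s t)"

definition shift :: "('o \<Rightarrow> 'o) \<Rightarrow> ('o \<Rightarrow> 'o) \<Rightarrow> int \<Rightarrow> 'o \<Rightarrow> 'o" where
  "shift Fo Go i X = (if i \<ge> 0 then (Fo ^^ nat i) X else (Go ^^ nat (- i)) X)"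


section \<open>Linear categories\<close>

definition zero_object :: "('o, 'm::zero) moncat \<Rightarrow> 'o \<Rightarrow> bool" where
  "zero_object C Z \<longleftrightarrow> Z \<in> Obj C \<and> (\<forall>X\<in>Obj C. Hom C X Z = {0} \<and> Hom C Z X = {0})"

text \<open>\<open>X \<simeq> A \<oplus> B\<close>\<close>

definition biproduct :: "('o, 'm::ab_group_add) moncat \<Rightarrow> 'o \<Rightarrow> 'o \<Rightarrow> 'o \<Rightarrow> bool" where
  "biproduct C X A B \<longleftrightarrow> X \<in> Obj C \<and> A \<in> Obj C \<and> B \<in> Obj C \<and>
     (\<exists>i\<in>Hom C A X. \<exists>p\<in>Hom C X A. \<exists>j\<in>Hom C B X. \<exists>q\<in>Hom C X B.
        p \<odot>\<^bsub>C\<^esub> i = Id C A \<and> q \<odot>\<^bsub>C\<^esub> j = Id C B \<and> p \<odot>\<^bsub>C\<^esub> j = 0 \<and> q \<odot>\<^bsub>C\<^esub> i = 0 \<and>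
        (i \<odot>\<^bsub>C\<^esub> p) + (j \<odot>\<^bsub>C\<^esub> q) = Id C X)"

definition direct_summand :: "('o, 'm::ab_group_add) moncat \<Rightarrow> 'o \<Rightarrow> 'o \<Rightarrow> bool" where
  "direct_summand C A X \<longleftrightarrow> (\<exists>B. biproduct C X A B)"

definition indecomposable :: "('o, 'm::ab_group_add) moncat \<Rightarrow> 'o \<Rightarrow> bool" where
  "indecomposable C X \<longleftrightarrow> X \<in> Obj C \<and> \<not> zero_object C X \<and>
     (\<forall>A B. biproduct C X A B \<longrightarrow> zero_object C A \<or> zero_object C B)"


section \<open>Duals\<close>

text \<open>\<open>L\<close> is a left dual of \<open>X\<close>: evaluation \<open>L \<otimes> X \<rightarrow> \<one>\<close>, coevaluation \<open>\<one> \<rightarrow> X \<otimes> L\<close>, and the two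
  zigzag identities.\<close>

definition is_left_dual :: "('o, 'm) moncat \<Rightarrow> 'o \<Rightarrow> 'o \<Rightarrow> bool" where
  "is_left_dual C L X \<longleftrightarrow> L \<in> Obj C \<and> X \<in> Obj C \<and>
     (\<exists>ev\<in>Hom C (L \<otimes>\<^bsub>C\<^esub> X) \<one>\<^bsub>C\<^esub>. \<exists>co\<in>Hom C \<one>\<^bsub>C\<^esub> (X \<otimes>\<^bsub>C\<^esub> L).
        RUnit C X \<odot>\<^bsub>C\<^esub> (Id C X \<boxtimes>\<^bsub>C\<^esub> ev) \<odot>\<^bsub>C\<^esub> Assoc C X L X \<odot>\<^bsub>C\<^esub> (co \<boxtimes>\<^bsub>C\<^esub> Id C X) = LUnit C X \<and>
        LUnit C L \<odot>\<^bsub>C\<^esub> (ev \<boxtimes>\<^bsub>C\<^esub> Id C L)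
          \<odot>\<^bsub>C\<^esub> inv_mor C ((L \<otimes>\<^bsub>C\<^esub> X) \<otimes>\<^bsub>C\<^esub> L) (L \<otimes>\<^bsub>C\<^esub> (X \<otimes>\<^bsub>C\<^esub> L)) (Assoc C L X L)
          \<odot>\<^bsub>C\<^esub> (Id C L \<boxtimes>\<^bsub>C\<^esub> co) = RUnit C L)"

text \<open>A right dual has \<open>X \<otimes> R \<rightarrow> \<one>\<close> and \<open>\<one> \<rightarrow> R \<otimes> X\<close>: the same data with the roles exchanged.\<close>

definition is_right_dual :: "('o, 'm) moncat \<Rightarrow> 'o \<Rightarrow> 'o \<Rightarrow> bool" where
  "is_right_dual C R X \<longleftrightarrow> is_left_dual C X R"

definition ldual :: "('o, 'm) moncat \<Rightarrow> 'o \<Rightarrow> 'o" where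
  "ldual C X = (SOME L. is_left_dual C L X)"

definition rdual :: "('o, 'm) moncat \<Rightarrow> 'o \<Rightarrow> 'o" where
  "rdual C X = (SOME R. is_right_dual C R X)"


section \<open>Pseudo-tensor categories\<close>

locale pseudo_tensor_category = monoidal_category C + vector_space scale
  for C :: "('o, 'm::ab_group_add) moncat" (structure)
    and scale :: "'k::field \<Rightarrow> 'm \<Rightarrow> 'm" +
  assumes Hom_subspace: "\<lbrakk>X \<in> Obj C; Y \<in> Obj C\<rbrakk> \<Longrightarrow> subspace (Hom C X Y)"
    and Comp_add_left: "\<lbrakk>X \<in> Obj C; Y \<in> Obj C; Z \<in> Obj C;
      f \<in> Hom C X Y; g \<in> Hom C Y Z; g' \<in> Hom C Y Z\<rbrakk> \<Longrightarrow> (g + g') \<odot> f = (g \<odot> f) + (g' \<odot> f)"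
    and Comp_add_right: "\<lbrakk>X \<in> Obj C; Y \<in> Obj C; Z \<in> Obj C;
      f \<in> Hom C X Y; f' \<in> Hom C X Y; g \<in> Hom C Y Z\<rbrakk> \<Longrightarrow> g \<odot> (f + f') = (g \<odot> f) + (g \<odot> f')"
    and Comp_scale_left: "\<lbrakk>X \<in> Obj C; Y \<in> Obj C; Z \<in> Obj C; f \<in> Hom C X Y; g \<in> Hom C Y Z\<rbrakk>
      \<Longrightarrow> scale c g \<odot> f = scale c (g \<odot> f)"
    and Comp_scale_right: "\<lbrakk>X \<in> Obj C; Y \<in> Obj C; Z \<in> Obj C; f \<in> Hom C X Y; g \<in> Hom C Y Z\<rbrakk>
      \<Longrightarrow> g \<odot> scale c f = scale c (g \<odot> f)"
    and TensM_add_left: "\<lbrakk>X \<in> Obj C; X' \<in> Obj C; Y \<in> Obj C; Y' \<in> Obj C;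
      f \<in> Hom C X X'; f' \<in> Hom C X X'; g \<in> Hom C Y Y'\<rbrakk> \<Longrightarrow> (f + f') \<boxtimes> g = (f \<boxtimes> g) + (f' \<boxtimes> g)"
    and TensM_add_right: "\<lbrakk>X \<in> Obj C; X' \<in> Obj C; Y \<in> Obj C; Y' \<in> Obj C;
      f \<in> Hom C X X'; g \<in> Hom C Y Y'; g' \<in> Hom C Y Y'\<rbrakk> \<Longrightarrow> f \<boxtimes> (g + g') = (f \<boxtimes> g) + (f \<boxtimes> g')"
    and TensM_scale_left: "\<lbrakk>X \<in> Obj C; X' \<in> Obj C; Y \<in> Obj C; Y' \<in> Obj C;
      f \<in> Hom C X X'; g \<in> Hom C Y Y'\<rbrakk> \<Longrightarrow> scale c f \<boxtimes> g = scale c (f \<boxtimes> g)"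
    and TensM_scale_right: "\<lbrakk>X \<in> Obj C; X' \<in> Obj C; Y \<in> Obj C; Y' \<in> Obj C;
      f \<in> Hom C X X'; g \<in> Hom C Y Y'\<rbrakk> \<Longrightarrow> f \<boxtimes> scale c g = scale c (f \<boxtimes> g)"
    and zero_object_exists: "\<exists>Z. zero_object C Z"
    and biproduct_exists: "\<lbrakk>A \<in> Obj C; B \<in> Obj C\<rbrakk> \<Longrightarrow> \<exists>X. biproduct C X A B"
    and idempotents_split: "\<lbrakk>X \<in> Obj C; e \<in> Hom C X X; e \<odot> e = e\<rbrakk>
      \<Longrightarrow> \<exists>Y\<in>Obj C. \<exists>i\<in>Hom C Y X. \<exists>p\<in>Hom C X Y. p \<odot> i = Id C Y \<and> i \<odot> p = e"
    and Hom_finite_dim: "\<lbrakk>X \<in> Obj C; Y \<in> Obj C\<rbrakk> \<Longrightarrow> \<exists>A. finite A \<and> span A = Hom C X Y"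
    and End_Unit: "bij_betw (\<lambda>c. scale c (Id C \<one>)) UNIV (Hom C \<one> \<one>)"
    and left_dual_exists: "X \<in> Obj C \<Longrightarrow> \<exists>L. is_left_dual C L X"
    and right_dual_exists: "X \<in> Obj C \<Longrightarrow> \<exists>R. is_right_dual C R X"


section \<open>The invariants of the family \<open>B\<close>\<close>

text \<open>\<open>lstar\<close> is \<open>x\<^sup>*\<close> and \<open>rstar\<close> is its right-dual counterpart; if \<open>X\<^sup>*\<^sup>* \<simeq> X\<close> for all \<open>X\<close>, both are \<open>x\<close> inverse.\<close>

definition lstar :: "('o, 'm) moncat \<Rightarrow> 'w set \<Rightarrow> ('w \<Rightarrow> 'o) \<Rightarrow> 'w \<Rightarrow> 'w" where
  "lstar C W B x = (THE y. y \<in> W \<and> isomorphic C (ldual C (B x)) (B y))"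

definition rstar :: "('o, 'm) moncat \<Rightarrow> 'w set \<Rightarrow> ('w \<Rightarrow> 'o) \<Rightarrow> 'w \<Rightarrow> 'w" where
  "rstar C W B x = (THE y. y \<in> W \<and> isomorphic C (rdual C (B x)) (B y))"

text \<open>
  The supremum is taken in \<open>ereal\<close>; a nonempty set of integers has the same supremum there
  as in the integers extended by \<open>\<infinity>\<close>. The infimum of the empty set in \<open>enat\<close> is \<open>\<infinity>\<close>.
\<close>

definition a_fun ::
  "('o, 'm::ab_group_add) moncat \<Rightarrow> ('o \<Rightarrow> 'o) \<Rightarrow> ('o \<Rightarrow> 'o) \<Rightarrow> 'w set \<Rightarrow> ('w \<Rightarrow> 'o) \<Rightarrow> 'w \<Rightarrow> ereal"
  where
  "a_fun C Fo Go W B x =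
     Sup {ereal (of_int i) | i.
       \<exists>y\<in>W. \<exists>z\<in>W. direct_summand C (shift Fo Go i (B x)) (B y \<otimes>\<^bsub>C\<^esub> B z)}"

definition Delta_fun ::
  "('o, 'm::ab_group_add) moncat \<Rightarrow> ('o \<Rightarrow> 'o) \<Rightarrow> ('o \<Rightarrow> 'o) \<Rightarrow> ('w \<Rightarrow> 'o) \<Rightarrow> 'w \<Rightarrow> enat" where
  "Delta_fun C Fo Go B x =
     Inf {enat i | i. Hom C \<one>\<^bsub>C\<^esub> (shift Fo Go (int i) (B x)) \<noteq> {0}}"

definition D_set ::
  "('o, 'm::ab_group_add) moncat \<Rightarrow> ('o \<Rightarrow> 'o) \<Rightarrow> ('o \<Rightarrow> 'o) \<Rightarrow> 'w set \<Rightarrow> ('w \<Rightarrow> 'o) \<Rightarrow> 'w set" where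
  "D_set C Fo Go W B =
     {x \<in> W. a_fun C Fo Go W B x = ereal_of_enat (Delta_fun C Fo Go B x) \<and>
             Delta_fun C Fo Go B x < \<infinity>}"

end

theory Submission
  imports Defs
begin

text \<open>
  Let \<open>d\<close> be in \<open>\<D>\<close> and let \<open>n\<close> be the common value of \<open>a\<close> and \<open>\<Delta>\<close> at \<open>d\<close>. Then \<open>A = B\<^sub>d\<langle>n\<rangle>\<close> is a direct
  summand of some \<open>B\<^sub>y \<otimes> B\<^sub>z\<close>, say with projection \<open>p\<close>, and there is a nonzero \<open>f : \<one> \<rightarrow> A\<close>. So
  \<open>Hom(\<one>, B\<^sub>y \<otimes> B\<^sub>z) = Hom(B\<^sub>y\<^sup>*, B\<^sub>z)\<close> is nonzero; by orthonormality \<open>B\<^sub>z\<close> is the dual of \<open>B\<^sub>y\<close>, and the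
  composite \<open>u : \<one> \<rightarrow> A \<rightarrow> B\<^sub>y \<otimes> B\<^sub>z\<close> is a coevaluation, that is, the unit of the internal endomorphism
  algebra \<open>X = B\<^sub>y \<otimes> B\<^sub>y\<^sup>*\<close> (\<open>unit_map_tensor\<close>).

  The contravariant equivalence \<open>I\<close> fixes \<open>X\<close> up to isomorphism and sends \<open>A\<close> to \<open>B\<^sub>d\<langle>-n\<rangle>\<close>. Hence
  \<open>I(p) : I(A) \<rightarrow> X\<close> and \<open>I(u) : X \<rightarrow> \<one>\<close>, with composite \<open>I(p u) = I(f) \<noteq> 0\<close>. Multiplication of \<open>X\<close> followed by
  \<open>I(u)\<close> restricts to a pairing \<open>A \<otimes> I(A) \<rightarrow> \<one>\<close>. Inserting \<open>f\<close> on the left multiplies with the unit and leaves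
  \<open>I(f)\<close>, so the pairing is nonzero (\<open>duality_pairing\<close>, \<open>retract_pairing_nonzero\<close>). The shifts cancel in
  \<open>A \<otimes> I(A)\<close>, which gives a nonzero \<open>B\<^sub>d \<otimes> B\<^sub>d \<rightarrow> \<one>\<close>, and \<open>I\<close> turns it into a nonzero \<open>\<one> \<rightarrow> B\<^sub>d \<otimes> B\<^sub>d\<close>.
  By adjunction and orthonormality again, \<open>B\<^sub>d\<^sup>*\<close> is isomorphic to \<open>B\<^sub>d\<close>. The right dual follows from the
  left one by \<open>X\<^sup>*\<^sup>* \<simeq> X\<close>.

  Duality enters through the fact that \<open>Y \<otimes> Y\<^sup>*\<close> acts on \<open>Y \<otimes> Z\<close> with its unit acting trivially
  (\<open>zigzag_action\<close>), and through the adjunction that follows (\<open>zigzag_factor\<close>). Since the associator is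
  not strict, both rest on Kelly's coherence lemmas.
\<close>

section \<open>Typed arrows\<close>

text \<open>
  Composition in \<open>moncat\<close> carries no objects, so the premises of the category laws mention objects that
  the terms do not determine, and the simplifier cannot discharge them. Bundling a morphism with its
  source and target makes all side conditions computable.
\<close>

type_synonym ('o, 'm) arrow = "'o \<times> 'm \<times> 'o"

definition src :: "('o, 'm) arrow \<Rightarrow> 'o" where "src t = fst t"
definition mor :: "('o, 'm) arrow \<Rightarrow> 'm" where "mor t = fst (snd t)"
definition tgt :: "('o, 'm) arrow \<Rightarrow> 'o" where "tgt t = snd (snd t)"

lemma arrow_sel [simp]: "src (X, f, Y) = X" "mor (X, f, Y) = f" "tgt (X, f, Y) = Y"
  by (simp_all add: src_def mor_def tgt_def)

lemma arrow_eqI: "src s = src t \<Longrightarrow> mor s = mor t \<Longrightarrow> tgt s = tgt t \<Longrightarrow> s = t"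
  by (simp add: src_def mor_def tgt_def prod_eq_iff)

context category
begin

definition arr :: "('o, 'm) arrow \<Rightarrow> bool" where
  "arr t \<longleftrightarrow> src t \<in> Obj C \<and> tgt t \<in> Obj C \<and> mor t \<in> Hom C (src t) (tgt t)"

definition ida :: "'o \<Rightarrow> ('o, 'm) arrow"  ("\<iota>") where
  "\<iota> X = (X, Id C X, X)"

definition cmp :: "('o, 'm) arrow \<Rightarrow> ('o, 'm) arrow \<Rightarrow> ('o, 'm) arrow"  (infixr "\<cdot>" 55) where
  "g \<cdot> f = (src f, mor g \<odot> mor f, tgt g)"

lemma arr_obj [simp]: "arr t \<Longrightarrow> src t \<in> Obj C" "arr t \<Longrightarrow> tgt t \<in> Obj C"
  by (simp_all add: arr_def)

lemma arr_triple [simp]: "arr (X, f, Y) \<longleftrightarrow> X \<in> Obj C \<and> Y \<in> Obj C \<and> f \<in> Hom C X Y"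
  by (simp add: arr_def del: arr_obj)

lemma src_cmp [simp]: "src (g \<cdot> f) = src f" and tgt_cmp [simp]: "tgt (g \<cdot> f) = tgt g"
  and mor_cmp: "mor (g \<cdot> f) = mor g \<odot> mor f"
  by (simp_all add: cmp_def)

lemma src_ida [simp]: "src (\<iota> X) = X" and tgt_ida [simp]: "tgt (\<iota> X) = X"
  and mor_ida: "mor (\<iota> X) = Id C X"
  by (simp_all add: ida_def)

lemma arr_ida [simp]: "X \<in> Obj C \<Longrightarrow> arr (\<iota> X)"
  by (simp add: ida_def Id_in_Hom)

lemma arr_cmp [simp]: "\<lbrakk>arr f; arr g; tgt f = src g\<rbrakk> \<Longrightarrow> arr (g \<cdot> f)"
  using Comp_in_Hom[of "src f" "tgt f" "tgt g"] by (simp add: arr_def cmp_def del: arr_obj)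

lemma cmp_ida [simp]: "\<lbrakk>arr f; src f = X\<rbrakk> \<Longrightarrow> f \<cdot> \<iota> X = f"
  using Comp_Id[of "src f" "tgt f"] by (auto intro!: arrow_eqI simp: arr_def mor_cmp mor_ida
      simp del: arr_obj)

lemma ida_cmp [simp]: "\<lbrakk>arr f; tgt f = X\<rbrakk> \<Longrightarrow> \<iota> X \<cdot> f = f"
  using Id_Comp[of "src f" "tgt f"] by (auto intro!: arrow_eqI simp: arr_def mor_cmp mor_ida
      simp del: arr_obj)

lemma cmp_assoc: "\<lbrakk>arr f; arr g; arr h; tgt f = src g; tgt g = src h\<rbrakk> \<Longrightarrow> (h \<cdot> g) \<cdot> f = h \<cdot> (g \<cdot> f)"
  using Comp_assoc[of "src f" "tgt f" "tgt g" "tgt h"]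
  by (auto intro!: arrow_eqI simp: arr_def mor_cmp
      simp del: arr_obj)

definition inverse_arrows :: "('o, 'm) arrow \<Rightarrow> ('o, 'm) arrow \<Rightarrow> bool" where
  "inverse_arrows a b \<longleftrightarrow> arr a \<and> arr b \<and> src b = tgt a \<and> tgt b = src a
     \<and> b \<cdot> a = \<iota> (src a) \<and> a \<cdot> b = \<iota> (tgt a)"

lemma is_iso_inverse_arrow:
  assumes "is_iso C X Y f" "X \<in> Obj C" "Y \<in> Obj C"
  obtains b where "inverse_arrows (X, f, Y) b"
  using assms unfolding is_iso_def inverse_pair_def inverse_arrows_def
  by (force intro!: arrow_eqI simp: mor_cmp mor_ida)

lemma iso_cancel_left:
  assumes ab: "inverse_arrows a b" and f: "arr f" "tgt f = src a" and g: "arr g" "tgt g = src a"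
    and eq: "a \<cdot> f = a \<cdot> g"
  shows "f = g"
proof -
  have b: "arr a" "arr b" "src b = tgt a" "b \<cdot> a = \<iota> (src a)"
    using ab by (simp_all add: inverse_arrows_def)
  have "f = (b \<cdot> a) \<cdot> f" using f b(4) by simp
  also have "\<dots> = b \<cdot> (a \<cdot> f)" using cmp_assoc[OF f(1) b(1,2)] f(2) b(3) by simp
  also have "\<dots> = b \<cdot> (a \<cdot> g)" by (simp only: eq)
  also have "\<dots> = (b \<cdot> a) \<cdot> g" using cmp_assoc[OF g(1) b(1,2)] g(2) b(3) by simp
  also have "\<dots> = g" using g b(4) by simp
  finally show ?thesis .
qed

lemma iso_cancel_right:
  assumes ab: "inverse_arrows a b" and f: "arr f" "src f = tgt a" and g: "arr g" "src g = tgt a"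
    and eq: "f \<cdot> a = g \<cdot> a"
  shows "f = g"
proof -
  have b: "arr a" "arr b" "tgt b = src a" "a \<cdot> b = \<iota> (tgt a)"
    using ab by (simp_all add: inverse_arrows_def)
  have "f = f \<cdot> (a \<cdot> b)" using f b(4) by simp
  also have "\<dots> = (f \<cdot> a) \<cdot> b" using cmp_assoc[OF b(2,1) f(1)] f(2) b(3) by simp
  also have "\<dots> = (g \<cdot> a) \<cdot> b" by (simp only: eq)
  also have "\<dots> = g \<cdot> (a \<cdot> b)" using cmp_assoc[OF b(2,1) g(1)] g(2) b(3) by simp
  also have "\<dots> = g" using g b(4) by simp
  finally show ?thesis .
qed

lemma isomorphic_arrows:
  assumes "isomorphic C X Y" "X \<in> Obj C" "Y \<in> Obj C"
  obtains a b where "inverse_arrows a b" "src a = X" "tgt a = Y"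
  using assms is_iso_inverse_arrow unfolding isomorphic_def by (metis arrow_sel(1,3))

lemma inverse_arrowsD:
  assumes "inverse_arrows a b"
  shows "arr a" "arr b" "src b = tgt a" "tgt b = src a" "b \<cdot> a = \<iota> (src a)" "a \<cdot> b = \<iota> (tgt a)"
  using assms by (simp_all add: inverse_arrows_def)

lemma inverse_arrows_isomorphic:
  assumes "inverse_arrows a b"
  shows "isomorphic C (src a) (tgt a)"
proof -
  note ab = inverse_arrowsD[OF assms]
  have "mor b \<odot> mor a = Id C (src a)" "mor a \<odot> mor b = Id C (tgt a)"
    using arg_cong[OF ab(5), of mor] arg_cong[OF ab(6), of mor] by (simp_all add: mor_cmp mor_ida)
  then have "inverse_pair C (src a) (tgt a) (mor a) (mor b)"
    using ab(1-4) unfolding inverse_pair_def arr_def by simp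
  then show ?thesis unfolding isomorphic_def is_iso_def by blast
qed

lemma isomorphic_refl: "X \<in> Obj C \<Longrightarrow> isomorphic C X X"
  using inverse_arrows_isomorphic[of "\<iota> X" "\<iota> X"] by (simp add: inverse_arrows_def)

lemma isomorphic_sym: "isomorphic C X Y \<Longrightarrow> isomorphic C Y X"
  unfolding isomorphic_def is_iso_def inverse_pair_def by blast

lemma inverse_arrows_cmp:
  assumes a: "inverse_arrows a b" and c: "inverse_arrows c d" and ac: "tgt a = src c"
  shows "inverse_arrows (c \<cdot> a) (b \<cdot> d)"
proof -
  note ab = inverse_arrowsD[OF a] and cd = inverse_arrowsD[OF c]
  have "(b \<cdot> d) \<cdot> (c \<cdot> a) = b \<cdot> ((d \<cdot> c) \<cdot> a)"
    using ab(1-4) cd(1-4) ac by (simp add: cmp_assoc)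
  moreover have "(c \<cdot> a) \<cdot> (b \<cdot> d) = c \<cdot> ((a \<cdot> b) \<cdot> d)"
    using ab(1-4) cd(1-4) ac by (simp add: cmp_assoc)
  ultimately show ?thesis
    using ab cd ac by (simp add: inverse_arrows_def)
qed

lemma isomorphic_trans:
  assumes "isomorphic C X Y" "isomorphic C Y Z" "X \<in> Obj C" "Y \<in> Obj C" "Z \<in> Obj C"
  shows "isomorphic C X Z"
proof -
  obtain a b where a: "inverse_arrows a b" "src a = X" "tgt a = Y"
    using isomorphic_arrows assms by metis
  obtain c d where c: "inverse_arrows c d" "src c = Y" "tgt c = Z"
    using isomorphic_arrows assms by metis
  show ?thesis
    using inverse_arrows_isomorphic[OF inverse_arrows_cmp[OF a(1) c(1)]] a c by simp
qed

end

context monoidal_category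
begin

definition tns :: "('a, 'b) arrow \<Rightarrow> ('a, 'b) arrow \<Rightarrow> ('a, 'b) arrow"  (infixr "\<star>" 65) where
  "f \<star> g = (src f \<otimes> src g, mor f \<boxtimes> mor g, tgt f \<otimes> tgt g)"

definition asc :: "'a \<Rightarrow> 'a \<Rightarrow> 'a \<Rightarrow> ('a, 'b) arrow"  ("\<alpha>") where
  "\<alpha> X Y Z = ((X \<otimes> Y) \<otimes> Z, Assoc C X Y Z, X \<otimes> (Y \<otimes> Z))"

definition lun :: "'a \<Rightarrow> ('a, 'b) arrow"  ("\<lambda>\<^sub>u") where
  "\<lambda>\<^sub>u X = (\<one> \<otimes> X, LUnit C X, X)"

definition run :: "'a \<Rightarrow> ('a, 'b) arrow"  ("\<rho>\<^sub>u") where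
  "\<rho>\<^sub>u X = (X \<otimes> \<one>, RUnit C X, X)"

lemma structure_arrow_sel [simp]:
  "src (f \<star> g) = src f \<otimes> src g" "tgt (f \<star> g) = tgt f \<otimes> tgt g"
  "src (\<alpha> X Y Z) = (X \<otimes> Y) \<otimes> Z" "tgt (\<alpha> X Y Z) = X \<otimes> (Y \<otimes> Z)"
  "src (\<lambda>\<^sub>u X) = \<one> \<otimes> X" "tgt (\<lambda>\<^sub>u X) = X"
  "src (\<rho>\<^sub>u X) = X \<otimes> \<one>" "tgt (\<rho>\<^sub>u X) = X"
  by (simp_all add: tns_def asc_def lun_def run_def)

lemma structure_arrow_mor:
  "mor (f \<star> g) = mor f \<boxtimes> mor g" "mor (\<alpha> X Y Z) = Assoc C X Y Z"
  "mor (\<lambda>\<^sub>u X) = LUnit C X" "mor (\<rho>\<^sub>u X) = RUnit C X"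
  by (simp_all add: tns_def asc_def lun_def run_def)

lemmas [simp] = Unit_Obj TensO_Obj

lemma arr_structure [simp]:
  "\<lbrakk>X \<in> Obj C; Y \<in> Obj C; Z \<in> Obj C\<rbrakk> \<Longrightarrow> arr (\<alpha> X Y Z)"
  "X \<in> Obj C \<Longrightarrow> arr (\<lambda>\<^sub>u X)"
  "X \<in> Obj C \<Longrightarrow> arr (\<rho>\<^sub>u X)"
  using Assoc_iso[of X Y Z] LUnit_iso[of X] RUnit_iso[of X]
  by (auto simp: arr_def structure_arrow_mor is_iso_def inverse_pair_def
      simp del: arr_obj)

lemma arr_tns [simp]: "\<lbrakk>arr f; arr g\<rbrakk> \<Longrightarrow> arr (f \<star> g)"
  using TensM_in_Hom by (simp add: arr_def structure_arrow_mor del: arr_obj)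

lemma tns_ida [simp]: "\<lbrakk>X \<in> Obj C; Y \<in> Obj C\<rbrakk> \<Longrightarrow> \<iota> X \<star> \<iota> Y = \<iota> (X \<otimes> Y)"
  by (rule arrow_eqI) (simp_all add: structure_arrow_mor mor_ida TensM_Id)

lemma tns_cmp: "\<lbrakk>arr f; arr f'; arr g; arr g'; tgt f = src f'; tgt g = src g'\<rbrakk>
  \<Longrightarrow> (f' \<cdot> f) \<star> (g' \<cdot> g) = (f' \<star> g') \<cdot> (f \<star> g)"
  using interchange[of "src f" "tgt f" "tgt f'" "src g" "tgt g" "tgt g'"]
  by (auto intro!: arrow_eqI simp: structure_arrow_mor mor_cmp arr_def
      simp del: arr_obj)

lemma whisker_left: "\<lbrakk>X \<in> Obj C; arr g; arr g'; tgt g = src g'\<rbrakk>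
  \<Longrightarrow> \<iota> X \<star> (g' \<cdot> g) = (\<iota> X \<star> g') \<cdot> (\<iota> X \<star> g)"
  using tns_cmp[of "\<iota> X" "\<iota> X" g g'] by simp

lemma whisker_right: "\<lbrakk>X \<in> Obj C; arr g; arr g'; tgt g = src g'\<rbrakk>
  \<Longrightarrow> (g' \<cdot> g) \<star> \<iota> X = (g' \<star> \<iota> X) \<cdot> (g \<star> \<iota> X)"
  using tns_cmp[of g g' "\<iota> X" "\<iota> X"] by simp

lemma asc_natural: "\<lbrakk>arr f; arr g; arr h\<rbrakk>
  \<Longrightarrow> \<alpha> (tgt f) (tgt g) (tgt h) \<cdot> ((f \<star> g) \<star> h) = (f \<star> (g \<star> h)) \<cdot> \<alpha> (src f) (src g) (src h)"
  using Assoc_natural[of "src f" "tgt f" "src g" "tgt g" "src h" "tgt h"]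
  by (auto intro!: arrow_eqI simp: structure_arrow_mor mor_cmp arr_def
      simp del: arr_obj)

lemma lun_natural: "arr f \<Longrightarrow> \<lambda>\<^sub>u (tgt f) \<cdot> (\<iota> \<one> \<star> f) = f \<cdot> \<lambda>\<^sub>u (src f)"
  using LUnit_natural[of "src f" "tgt f"]
  by (auto intro!: arrow_eqI simp: structure_arrow_mor mor_cmp mor_ida arr_def
      simp del: arr_obj)

lemma run_natural: "arr f \<Longrightarrow> \<rho>\<^sub>u (tgt f) \<cdot> (f \<star> \<iota> \<one>) = f \<cdot> \<rho>\<^sub>u (src f)"
  using RUnit_natural[of "src f" "tgt f"]
  by (auto intro!: arrow_eqI simp: structure_arrow_mor mor_cmp mor_ida arr_def
      simp del: arr_obj)

lemma pentagon_arrow: "\<lbrakk>X \<in> Obj C; Y \<in> Obj C; Z \<in> Obj C; U \<in> Obj C\<rbrakk>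
  \<Longrightarrow> (\<iota> X \<star> \<alpha> Y Z U) \<cdot> \<alpha> X (Y \<otimes> Z) U \<cdot> (\<alpha> X Y Z \<star> \<iota> U) = \<alpha> X Y (Z \<otimes> U) \<cdot> \<alpha> (X \<otimes> Y) Z U"
  using pentagon[of X Y Z U]
  by (auto intro!: arrow_eqI simp: structure_arrow_mor mor_cmp mor_ida)

lemma triangle_arrow: "\<lbrakk>X \<in> Obj C; Y \<in> Obj C\<rbrakk>
  \<Longrightarrow> (\<iota> X \<star> \<lambda>\<^sub>u Y) \<cdot> \<alpha> X \<one> Y = \<rho>\<^sub>u X \<star> \<iota> Y"
  using triangle[of X Y]
  by (auto intro!: arrow_eqI simp: structure_arrow_mor mor_cmp mor_ida)

lemma asc_inverse:
  assumes "X \<in> Obj C" "Y \<in> Obj C" "Z \<in> Obj C"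
  obtains b where "inverse_arrows (\<alpha> X Y Z) b"
  using is_iso_inverse_arrow[OF Assoc_iso[OF assms]] assms unfolding asc_def by (auto simp: assms)

lemma lun_inverse:
  assumes "X \<in> Obj C"
  obtains b where "inverse_arrows (\<lambda>\<^sub>u X) b"
  using is_iso_inverse_arrow[OF LUnit_iso[OF assms]] assms unfolding lun_def by auto

lemma run_inverse:
  assumes "X \<in> Obj C"
  obtains b where "inverse_arrows (\<rho>\<^sub>u X) b"
  using is_iso_inverse_arrow[OF RUnit_iso[OF assms]] assms unfolding run_def by auto

text \<open>
  Naturality of the unit constraint makes tensoring with the unit object conjugate to the identity
  functor. Equations of structure arrows may therefore be checked after tensoring with \<open>\<one>\<close>, where
  pentagon and triangle apply.
\<close>

lemma unit_tns_faithful: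
  assumes "arr f" "arr g" "src f = src g" "tgt f = tgt g" "\<iota> \<one> \<star> f = \<iota> \<one> \<star> g"
  shows "f = g"
proof -
  obtain b where b: "inverse_arrows (\<lambda>\<^sub>u (src f)) b" using lun_inverse assms(1) by (metis arr_obj(1))
  have "f \<cdot> \<lambda>\<^sub>u (src f) = g \<cdot> \<lambda>\<^sub>u (src f)"
    using lun_natural[OF assms(1)] lun_natural[OF assms(2)] assms by simp
  then show ?thesis
    by (intro iso_cancel_right[OF b assms(1) _ assms(2)]) (simp_all add: assms(3))
qed

lemma tns_unit_faithful:
  assumes "arr f" "arr g" "src f = src g" "tgt f = tgt g" "f \<star> \<iota> \<one> = g \<star> \<iota> \<one>"
  shows "f = g"
proof -
  obtain b where b: "inverse_arrows (\<rho>\<^sub>u (src f)) b" using run_inverse assms(1) by (metis arr_obj(1))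
  have "f \<cdot> \<rho>\<^sub>u (src f) = g \<cdot> \<rho>\<^sub>u (src f)"
    using run_natural[OF assms(1)] run_natural[OF assms(2)] assms by simp
  then show ?thesis
    by (intro iso_cancel_right[OF b assms(1) _ assms(2)]) (simp_all add: assms(3))
qed

lemma inverse_arrows_whisker_right:
  assumes "inverse_arrows a b" "X \<in> Obj C"
  shows "inverse_arrows (a \<star> \<iota> X) (b \<star> \<iota> X)"
  using assms whisker_right[of X a b] whisker_right[of X b a] by (simp add: inverse_arrows_def)

lemma inverse_arrows_whisker_left:
  assumes "inverse_arrows a b" "X \<in> Obj C"
  shows "inverse_arrows (\<iota> X \<star> a) (\<iota> X \<star> b)"
  using assms whisker_left[of X a b] whisker_left[of X b a] by (simp add: inverse_arrows_def)

lemma inverse_arrows_tns: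
  assumes "inverse_arrows a b" "inverse_arrows c d"
  shows "inverse_arrows (a \<star> c) (b \<star> d)"
proof -
  note ab = inverse_arrowsD[OF assms(1)] and cd = inverse_arrowsD[OF assms(2)]
  have "(b \<star> d) \<cdot> (a \<star> c) = (b \<cdot> a) \<star> (d \<cdot> c)" "(a \<star> c) \<cdot> (b \<star> d) = (a \<cdot> b) \<star> (c \<cdot> d)"
    using ab(1-4) cd(1-4) by (simp_all add: tns_cmp)
  then show ?thesis using ab cd by (simp add: inverse_arrows_def)
qed

lemma isomorphic_TensO:
  assumes "isomorphic C X X'" "isomorphic C Y Y'"
    "X \<in> Obj C" "X' \<in> Obj C" "Y \<in> Obj C" "Y' \<in> Obj C"
  shows "isomorphic C (X \<otimes> Y) (X' \<otimes> Y')"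
proof -
  obtain a b where a: "inverse_arrows a b" "src a = X" "tgt a = X'"
    using isomorphic_arrows assms by metis
  obtain c d where c: "inverse_arrows c d" "src c = Y" "tgt c = Y'"
    using isomorphic_arrows assms by metis
  show ?thesis
    using inverse_arrows_isomorphic[OF inverse_arrows_tns[OF a(1) c(1)]] a c by simp
qed

end

section \<open>Coherence of the unit constraints\<close>

context monoidal_category
begin

text \<open>
  Kelly's three consequences of the pentagon and the triangle. For the first, the pentagon on
  \<open>X, Y, \<one>, \<one>\<close> is combined with the triangles for \<open>Y, \<one>\<close> and \<open>X \<otimes> Y, \<one>\<close>.
\<close>

lemma run_tensor:
  assumes X [simp]: "X \<in> Obj C" and Y [simp]: "Y \<in> Obj C"
  shows "(\<iota> X \<star> \<rho>\<^sub>u Y) \<cdot> \<alpha> X Y \<one> = \<rho>\<^sub>u (X \<otimes> Y)"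
proof (rule tns_unit_faithful)
  obtain b where b: "inverse_arrows (\<alpha> X Y \<one>) b" using asc_inverse[of X Y \<one>] by auto
  have "\<alpha> X Y \<one> \<cdot> (((\<iota> X \<star> \<rho>\<^sub>u Y) \<cdot> \<alpha> X Y \<one>) \<star> \<iota> \<one>)
      = (\<alpha> X Y \<one> \<cdot> ((\<iota> X \<star> \<rho>\<^sub>u Y) \<star> \<iota> \<one>)) \<cdot> (\<alpha> X Y \<one> \<star> \<iota> \<one>)"
    by (simp add: whisker_right cmp_assoc)
  also have "\<dots> = (\<iota> X \<star> (\<rho>\<^sub>u Y \<star> \<iota> \<one>)) \<cdot> \<alpha> X (Y \<otimes> \<one>) \<one> \<cdot> (\<alpha> X Y \<one> \<star> \<iota> \<one>)"
    using asc_natural[of "\<iota> X" "\<rho>\<^sub>u Y" "\<iota> \<one>"] by (simp add: cmp_assoc)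
  also have "\<dots> = (\<iota> X \<star> (\<iota> Y \<star> \<lambda>\<^sub>u \<one>)) \<cdot> (\<iota> X \<star> \<alpha> Y \<one> \<one>) \<cdot> \<alpha> X (Y \<otimes> \<one>) \<one> \<cdot> (\<alpha> X Y \<one> \<star> \<iota> \<one>)"
    by (simp add: triangle_arrow[symmetric] whisker_left cmp_assoc)
  also have "\<dots> = ((\<iota> X \<star> (\<iota> Y \<star> \<lambda>\<^sub>u \<one>)) \<cdot> \<alpha> X Y (\<one> \<otimes> \<one>)) \<cdot> \<alpha> (X \<otimes> Y) \<one> \<one>"
    by (simp add: pentagon_arrow cmp_assoc)
  also have "\<dots> = (\<alpha> X Y \<one> \<cdot> (\<iota> (X \<otimes> Y) \<star> \<lambda>\<^sub>u \<one>)) \<cdot> \<alpha> (X \<otimes> Y) \<one> \<one>"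
    using asc_natural[of "\<iota> X" "\<iota> Y" "\<lambda>\<^sub>u \<one>"] by simp
  also have "\<dots> = \<alpha> X Y \<one> \<cdot> (\<rho>\<^sub>u (X \<otimes> Y) \<star> \<iota> \<one>)"
    by (simp add: triangle_arrow[symmetric] cmp_assoc)
  finally show "((\<iota> X \<star> \<rho>\<^sub>u Y) \<cdot> \<alpha> X Y \<one>) \<star> \<iota> \<one> = \<rho>\<^sub>u (X \<otimes> Y) \<star> \<iota> \<one>"
    by (rule iso_cancel_left[OF b, rotated -1]) simp_all
qed simp_all

text \<open>
  The mirror image: the pentagon on \<open>\<one>, \<one>, X, Y\<close>, with the triangles for \<open>\<one>, X\<close> and \<open>\<one>, X \<otimes> Y\<close>.
\<close>

lemma lun_tensor:
  assumes X [simp]: "X \<in> Obj C" and Y [simp]: "Y \<in> Obj C"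
  shows "\<lambda>\<^sub>u (X \<otimes> Y) \<cdot> \<alpha> \<one> X Y = \<lambda>\<^sub>u X \<star> \<iota> Y"
proof (rule unit_tns_faithful)
  obtain b where b: "inverse_arrows (\<alpha> \<one> (\<one> \<otimes> X) Y) b" using asc_inverse[of \<one> "(\<one> \<otimes> X)" Y] by auto
  obtain b' where b': "inverse_arrows (\<alpha> \<one> \<one> X) b'" using asc_inverse[of \<one> \<one> X] by auto
  have "((\<iota> \<one> \<star> (\<lambda>\<^sub>u (X \<otimes> Y) \<cdot> \<alpha> \<one> X Y)) \<cdot> \<alpha> \<one> (\<one> \<otimes> X) Y) \<cdot> (\<alpha> \<one> \<one> X \<star> \<iota> Y)
      = (\<iota> \<one> \<star> \<lambda>\<^sub>u (X \<otimes> Y)) \<cdot> (\<iota> \<one> \<star> \<alpha> \<one> X Y) \<cdot> \<alpha> \<one> (\<one> \<otimes> X) Y \<cdot> (\<alpha> \<one> \<one> X \<star> \<iota> Y)"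
    by (simp add: whisker_left cmp_assoc)
  also have "\<dots> = ((\<iota> \<one> \<star> \<lambda>\<^sub>u (X \<otimes> Y)) \<cdot> \<alpha> \<one> \<one> (X \<otimes> Y)) \<cdot> \<alpha> (\<one> \<otimes> \<one>) X Y"
    by (simp add: pentagon_arrow cmp_assoc)
  also have "\<dots> = (\<rho>\<^sub>u \<one> \<star> \<iota> (X \<otimes> Y)) \<cdot> \<alpha> (\<one> \<otimes> \<one>) X Y"
    by (simp add: triangle_arrow)
  also have "\<dots> = \<alpha> \<one> X Y \<cdot> ((\<rho>\<^sub>u \<one> \<star> \<iota> X) \<star> \<iota> Y)"
    using asc_natural[of "\<rho>\<^sub>u \<one>" "\<iota> X" "\<iota> Y"] by simp
  also have "\<dots> = (\<alpha> \<one> X Y \<cdot> ((\<iota> \<one> \<star> \<lambda>\<^sub>u X) \<star> \<iota> Y)) \<cdot> (\<alpha> \<one> \<one> X \<star> \<iota> Y)"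
    by (simp add: triangle_arrow[symmetric] whisker_right cmp_assoc)
  also have "\<dots> = ((\<iota> \<one> \<star> (\<lambda>\<^sub>u X \<star> \<iota> Y)) \<cdot> \<alpha> \<one> (\<one> \<otimes> X) Y) \<cdot> (\<alpha> \<one> \<one> X \<star> \<iota> Y)"
    using asc_natural[of "\<iota> \<one>" "\<lambda>\<^sub>u X" "\<iota> Y"] by simp
  finally have "(\<iota> \<one> \<star> (\<lambda>\<^sub>u (X \<otimes> Y) \<cdot> \<alpha> \<one> X Y)) \<cdot> \<alpha> \<one> (\<one> \<otimes> X) Y
      = (\<iota> \<one> \<star> (\<lambda>\<^sub>u X \<star> \<iota> Y)) \<cdot> \<alpha> \<one> (\<one> \<otimes> X) Y"
    by (rule iso_cancel_right[OF inverse_arrows_whisker_right[OF b' Y], rotated -1]) simp_all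
  then show "\<iota> \<one> \<star> (\<lambda>\<^sub>u (X \<otimes> Y) \<cdot> \<alpha> \<one> X Y) = \<iota> \<one> \<star> (\<lambda>\<^sub>u X \<star> \<iota> Y)"
    by (rule iso_cancel_right[OF b, rotated -1]) simp_all
qed simp_all

text \<open>
  Naturality of \<open>\<lambda>\<^sub>u\<close> at \<open>\<lambda>\<^sub>u \<one>\<close> gives \<open>\<lambda>\<^sub>u (\<one> \<otimes> \<one>) = \<iota> \<one> \<star> \<lambda>\<^sub>u \<one>\<close>; this identifies the instances of
  \<open>lun_tensor\<close> and of the triangle at the unit object.
\<close>

lemma lun_unit: "\<lambda>\<^sub>u \<one> = \<rho>\<^sub>u \<one>"
proof (rule tns_unit_faithful)
  obtain b where b: "inverse_arrows (\<lambda>\<^sub>u \<one>) b" using lun_inverse[of \<one>] by auto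
  have "\<lambda>\<^sub>u (\<one> \<otimes> \<one>) = \<iota> \<one> \<star> \<lambda>\<^sub>u \<one>"
    by (rule iso_cancel_left[OF b]) (use lun_natural[of "\<lambda>\<^sub>u \<one>"] in simp_all)
  then show "\<lambda>\<^sub>u \<one> \<star> \<iota> \<one> = \<rho>\<^sub>u \<one> \<star> \<iota> \<one>"
    using lun_tensor[of \<one> \<one>] triangle_arrow[of \<one> \<one>] by simp
qed simp_all

end

section \<open>Duality and internal endomorphism algebras\<close>

context monoidal_category
begin

text \<open>
  The half of a left duality that makes \<open>Y \<otimes> L\<close> act on every \<open>Y \<otimes> Z\<close> with \<open>co\<close> acting trivially.
\<close>

definition duality_arrows :: "'a \<Rightarrow> 'a \<Rightarrow> ('a, 'b) arrow \<Rightarrow> ('a, 'b) arrow \<Rightarrow> bool" where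
  "duality_arrows L Y ev co \<longleftrightarrow> L \<in> Obj C \<and> Y \<in> Obj C
     \<and> arr ev \<and> src ev = L \<otimes> Y \<and> tgt ev = \<one> \<and> arr co \<and> src co = \<one> \<and> tgt co = Y \<otimes> L
     \<and> \<rho>\<^sub>u Y \<cdot> (\<iota> Y \<star> ev) \<cdot> \<alpha> Y L Y \<cdot> (co \<star> \<iota> Y) = \<lambda>\<^sub>u Y"

lemma left_dual_arrows:
  assumes "is_left_dual C L Y"
  obtains ev co where "duality_arrows L Y ev co"
proof -
  obtain e c where ec: "L \<in> Obj C" "Y \<in> Obj C" "e \<in> Hom C (L \<otimes> Y) \<one>" "c \<in> Hom C \<one> (Y \<otimes> L)"
    "RUnit C Y \<odot> (Id C Y \<boxtimes> e) \<odot> Assoc C Y L Y \<odot> (c \<boxtimes> Id C Y) = LUnit C Y"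
    using assms unfolding is_left_dual_def by blast
  have "duality_arrows L Y (L \<otimes> Y, e, \<one>) (\<one>, c, Y \<otimes> L)"
    unfolding duality_arrows_def
    using ec by (auto intro!: arrow_eqI simp: mor_cmp structure_arrow_mor mor_ida)
  then show thesis using that by blast
qed

text \<open>
  The object \<open>Y \<otimes> L\<close> is an internal endomorphism algebra with unit \<open>co\<close>, and \<open>n\<close>, the contraction of
  \<open>L\<close> with \<open>Y\<close>, induces its action on \<open>Y \<otimes> Z\<close>. The equation is the unit law of this module. It is
  the zigzag identity tensored with \<open>Z\<close>: the pentagon moves the contraction into the factor \<open>Y\<close>, and
  the two unit constraints that remain are matched by the triangle and by \<open>lun_tensor\<close>.
\<close>

lemma zigzag_action:
  assumes dual: "duality_arrows L Y ev co" and Z [simp]: "Z \<in> Obj C"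
  obtains n where "arr n" "src n = L \<otimes> (Y \<otimes> Z)" "tgt n = Z"
    "(\<iota> Y \<star> n) \<cdot> \<alpha> Y L (Y \<otimes> Z) \<cdot> (co \<star> \<iota> (Y \<otimes> Z)) = \<lambda>\<^sub>u (Y \<otimes> Z)"
proof -
  have Y [simp]: "Y \<in> Obj C" and [simp]: "L \<in> Obj C" "arr ev" "src ev = L \<otimes> Y" "tgt ev = \<one>"
      "arr co" "src co = \<one>" "tgt co = Y \<otimes> L"
    and zigzag: "\<rho>\<^sub>u Y \<cdot> (\<iota> Y \<star> ev) \<cdot> \<alpha> Y L Y \<cdot> (co \<star> \<iota> Y) = \<lambda>\<^sub>u Y"
    using dual by (simp_all add: duality_arrows_def)
  obtain b where b: "inverse_arrows (\<alpha> L Y Z) b" using asc_inverse[of L Y Z] by auto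
  then have [simp]: "arr b" "src b = L \<otimes> (Y \<otimes> Z)" "tgt b = (L \<otimes> Y) \<otimes> Z" "b \<cdot> \<alpha> L Y Z = \<iota> ((L \<otimes> Y) \<otimes> Z)"
    by (simp_all add: inverse_arrows_def)
  obtain c where c: "inverse_arrows (\<alpha> \<one> Y Z) c" using asc_inverse[of \<one> Y Z] by auto
  define n where "n = \<lambda>\<^sub>u Z \<cdot> (ev \<star> \<iota> Z) \<cdot> b"
  have n [simp]: "arr n" "src n = L \<otimes> (Y \<otimes> Z)" "tgt n = Z" by (simp_all add: n_def)
  have na: "n \<cdot> \<alpha> L Y Z = \<lambda>\<^sub>u Z \<cdot> (ev \<star> \<iota> Z)" by (simp add: n_def cmp_assoc)
  have "((\<iota> Y \<star> n) \<cdot> \<alpha> Y L (Y \<otimes> Z) \<cdot> (co \<star> \<iota> (Y \<otimes> Z))) \<cdot> \<alpha> \<one> Y Z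
      = (\<iota> Y \<star> n) \<cdot> (\<alpha> Y L (Y \<otimes> Z) \<cdot> \<alpha> (Y \<otimes> L) Y Z) \<cdot> ((co \<star> \<iota> Y) \<star> \<iota> Z)"
    using asc_natural[of co "\<iota> Y" "\<iota> Z"] by (simp add: cmp_assoc)
  also have "\<dots> = ((\<iota> Y \<star> n) \<cdot> (\<iota> Y \<star> \<alpha> L Y Z)) \<cdot> \<alpha> Y (L \<otimes> Y) Z \<cdot> (\<alpha> Y L Y \<star> \<iota> Z) \<cdot> ((co \<star> \<iota> Y) \<star> \<iota> Z)"
    by (simp add: pentagon_arrow[symmetric] cmp_assoc)
  also have "(\<iota> Y \<star> n) \<cdot> (\<iota> Y \<star> \<alpha> L Y Z) = (\<iota> Y \<star> \<lambda>\<^sub>u Z) \<cdot> (\<iota> Y \<star> (ev \<star> \<iota> Z))"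
    using whisker_left[of Y "\<alpha> L Y Z" n] by (simp add: na whisker_left)
  also have "((\<iota> Y \<star> \<lambda>\<^sub>u Z) \<cdot> (\<iota> Y \<star> (ev \<star> \<iota> Z))) \<cdot> \<alpha> Y (L \<otimes> Y) Z \<cdot> (\<alpha> Y L Y \<star> \<iota> Z) \<cdot> ((co \<star> \<iota> Y) \<star> \<iota> Z)
      = (\<iota> Y \<star> \<lambda>\<^sub>u Z) \<cdot> ((\<iota> Y \<star> (ev \<star> \<iota> Z)) \<cdot> \<alpha> Y (L \<otimes> Y) Z) \<cdot> (\<alpha> Y L Y \<star> \<iota> Z) \<cdot> ((co \<star> \<iota> Y) \<star> \<iota> Z)"
    by (simp add: cmp_assoc)
  also have "(\<iota> Y \<star> (ev \<star> \<iota> Z)) \<cdot> \<alpha> Y (L \<otimes> Y) Z = \<alpha> Y \<one> Z \<cdot> ((\<iota> Y \<star> ev) \<star> \<iota> Z)"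
    using asc_natural[of "\<iota> Y" ev "\<iota> Z"] by simp
  also have "(\<iota> Y \<star> \<lambda>\<^sub>u Z) \<cdot> (\<alpha> Y \<one> Z \<cdot> ((\<iota> Y \<star> ev) \<star> \<iota> Z)) \<cdot> (\<alpha> Y L Y \<star> \<iota> Z) \<cdot> ((co \<star> \<iota> Y) \<star> \<iota> Z)
      = ((\<iota> Y \<star> \<lambda>\<^sub>u Z) \<cdot> \<alpha> Y \<one> Z) \<cdot> ((\<iota> Y \<star> ev) \<star> \<iota> Z) \<cdot> (\<alpha> Y L Y \<star> \<iota> Z) \<cdot> ((co \<star> \<iota> Y) \<star> \<iota> Z)"
    by (simp add: cmp_assoc)
  also have "\<dots> = (\<rho>\<^sub>u Y \<cdot> (\<iota> Y \<star> ev) \<cdot> \<alpha> Y L Y \<cdot> (co \<star> \<iota> Y)) \<star> \<iota> Z"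
    by (simp add: triangle_arrow whisker_right)
  also have "\<dots> = \<lambda>\<^sub>u (Y \<otimes> Z) \<cdot> \<alpha> \<one> Y Z"
    by (simp only: zigzag lun_tensor Y Z)
  finally have "(\<iota> Y \<star> n) \<cdot> \<alpha> Y L (Y \<otimes> Z) \<cdot> (co \<star> \<iota> (Y \<otimes> Z)) = \<lambda>\<^sub>u (Y \<otimes> Z)"
    by (rule iso_cancel_right[OF c, rotated -1]) simp_all
  then show thesis using that n by blast
qed

text \<open>
  One half of the adjunction \<open>Hom(\<one>, Y \<otimes> Z) = Hom(L, Z)\<close>: contracting \<open>u\<close> with \<open>L\<close> gives
  \<open>\<phi>\<close>, and letting \<open>co\<close> act on \<open>u\<close> recovers \<open>u\<close> by the unit law while producing
  \<open>(\<iota> Y \<star> \<phi>) \<cdot> co\<close> by the interchange law.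
\<close>

lemma zigzag_factor:
  assumes dual: "duality_arrows L Y ev co" and Z [simp]: "Z \<in> Obj C"
    and u [simp]: "arr u" "src u = \<one>" "tgt u = Y \<otimes> Z"
  obtains \<phi> where "arr \<phi>" "src \<phi> = L" "tgt \<phi> = Z" "(\<iota> Y \<star> \<phi>) \<cdot> co = u"
proof -
  have [simp]: "Y \<in> Obj C" "L \<in> Obj C" "arr co" "src co = \<one>" "tgt co = Y \<otimes> L"
    using dual by (simp_all add: duality_arrows_def)
  obtain n where n [simp]: "arr n" "src n = L \<otimes> (Y \<otimes> Z)" "tgt n = Z"
    and act: "(\<iota> Y \<star> n) \<cdot> \<alpha> Y L (Y \<otimes> Z) \<cdot> (co \<star> \<iota> (Y \<otimes> Z)) = \<lambda>\<^sub>u (Y \<otimes> Z)"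
    using zigzag_action[OF dual Z] by blast
  obtain r where r: "inverse_arrows (\<rho>\<^sub>u L) r" using run_inverse[of L] by auto
  then have [simp]: "arr r" "src r = L" "tgt r = L \<otimes> \<one>" "r \<cdot> \<rho>\<^sub>u L = \<iota> (L \<otimes> \<one>)"
    by (simp_all add: inverse_arrows_def)
  obtain b where b: "inverse_arrows (\<rho>\<^sub>u \<one>) b" using run_inverse[of \<one>] by auto
  define \<phi> where "\<phi> = n \<cdot> (\<iota> L \<star> u) \<cdot> r"
  have \<phi> [simp]: "arr \<phi>" "src \<phi> = L" "tgt \<phi> = Z" by (simp_all add: \<phi>_def)
  have \<phi>r: "\<phi> \<cdot> \<rho>\<^sub>u L = n \<cdot> (\<iota> L \<star> u)" by (simp add: \<phi>_def cmp_assoc)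
  have "u \<cdot> \<rho>\<^sub>u \<one> = \<lambda>\<^sub>u (Y \<otimes> Z) \<cdot> (\<iota> \<one> \<star> u)"
    using lun_natural[of u] by (simp add: lun_unit)
  also have "\<dots> = (\<iota> Y \<star> n) \<cdot> \<alpha> Y L (Y \<otimes> Z) \<cdot> (co \<star> \<iota> (Y \<otimes> Z)) \<cdot> (\<iota> \<one> \<star> u)"
    by (simp add: act[symmetric] cmp_assoc)
  also have "(co \<star> \<iota> (Y \<otimes> Z)) \<cdot> (\<iota> \<one> \<star> u) = (\<iota> (Y \<otimes> L) \<star> u) \<cdot> (co \<star> \<iota> \<one>)"
    using tns_cmp[of "\<iota> \<one>" co u "\<iota> (Y \<otimes> Z)"] tns_cmp[of co "\<iota> (Y \<otimes> L)" "\<iota> \<one>" u] by simp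
  also have "(\<iota> Y \<star> n) \<cdot> \<alpha> Y L (Y \<otimes> Z) \<cdot> (\<iota> (Y \<otimes> L) \<star> u) \<cdot> (co \<star> \<iota> \<one>)
      = (\<iota> Y \<star> n) \<cdot> (\<alpha> Y L (Y \<otimes> Z) \<cdot> ((\<iota> Y \<star> \<iota> L) \<star> u)) \<cdot> (co \<star> \<iota> \<one>)"
    by (simp add: cmp_assoc)
  also have "\<alpha> Y L (Y \<otimes> Z) \<cdot> ((\<iota> Y \<star> \<iota> L) \<star> u) = (\<iota> Y \<star> (\<iota> L \<star> u)) \<cdot> \<alpha> Y L \<one>"
    using asc_natural[of "\<iota> Y" "\<iota> L" u] by simp
  also have "(\<iota> Y \<star> n) \<cdot> ((\<iota> Y \<star> (\<iota> L \<star> u)) \<cdot> \<alpha> Y L \<one>) \<cdot> (co \<star> \<iota> \<one>)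
      = (\<iota> Y \<star> (n \<cdot> (\<iota> L \<star> u))) \<cdot> \<alpha> Y L \<one> \<cdot> (co \<star> \<iota> \<one>)"
    by (simp add: whisker_left cmp_assoc)
  also have "\<dots> = (\<iota> Y \<star> \<phi>) \<cdot> ((\<iota> Y \<star> \<rho>\<^sub>u L) \<cdot> \<alpha> Y L \<one>) \<cdot> (co \<star> \<iota> \<one>)"
    by (simp add: \<phi>r[symmetric] whisker_left cmp_assoc)
  also have "\<dots> = ((\<iota> Y \<star> \<phi>) \<cdot> co) \<cdot> \<rho>\<^sub>u \<one>"
    using run_natural[of co] by (simp add: run_tensor cmp_assoc)
  finally have "u = (\<iota> Y \<star> \<phi>) \<cdot> co"
    by (rule iso_cancel_right[OF b, rotated -1]) simp_all
  then show thesis using that \<phi> by metis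
qed

text \<open>
  If the unit of the algebra \<open>Y \<otimes> L\<close> factors through \<open>A\<close>, then multiplication restricts to a
  pairing of \<open>A\<close> with any \<open>A'\<close> over \<open>Y \<otimes> L\<close>, and this pairing remembers \<open>b\<close>: multiplying with the unit
  changes nothing.
\<close>

lemma duality_pairing:
  assumes dual: "duality_arrows L Y ev co"
    and a [simp]: "arr a" "src a = A" "tgt a = Y \<otimes> L"
    and f [simp]: "arr f" "src f = \<one>" "tgt f = A" and af: "a \<cdot> f = co"
    and b [simp]: "arr b" "src b = A'" "tgt b = Y \<otimes> L"
  obtains g where "arr g" "src g = A \<otimes> A'" "tgt g = Y \<otimes> L" "g \<cdot> (f \<star> \<iota> A') = b \<cdot> \<lambda>\<^sub>u A'"
proof -
  have [simp]: "L \<in> Obj C" "Y \<in> Obj C" "arr co" "src co = \<one>" "tgt co = Y \<otimes> L"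
    using dual by (simp_all add: duality_arrows_def)
  have [simp]: "A' \<in> Obj C" using arr_obj(1)[OF b(1)] by simp
  obtain n where n [simp]: "arr n" "src n = L \<otimes> (Y \<otimes> L)" "tgt n = L"
    and act: "(\<iota> Y \<star> n) \<cdot> \<alpha> Y L (Y \<otimes> L) \<cdot> (co \<star> \<iota> (Y \<otimes> L)) = \<lambda>\<^sub>u (Y \<otimes> L)"
    using zigzag_action[OF dual, of L] by auto
  define g where "g = (\<iota> Y \<star> n) \<cdot> \<alpha> Y L (Y \<otimes> L) \<cdot> (a \<star> b)"
  have "(a \<star> b) \<cdot> (f \<star> \<iota> A') = (co \<star> \<iota> (Y \<otimes> L)) \<cdot> (\<iota> \<one> \<star> b)"
    using tns_cmp[of f a "\<iota> A'" b] tns_cmp[of "\<iota> \<one>" co b "\<iota> (Y \<otimes> L)"] by (simp add: af)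
  then have "g \<cdot> (f \<star> \<iota> A') = ((\<iota> Y \<star> n) \<cdot> \<alpha> Y L (Y \<otimes> L) \<cdot> (co \<star> \<iota> (Y \<otimes> L))) \<cdot> (\<iota> \<one> \<star> b)"
    by (simp add: g_def cmp_assoc)
  also have "\<dots> = b \<cdot> \<lambda>\<^sub>u A'"
    using lun_natural[of b] by (simp only: act) simp
  finally have "g \<cdot> (f \<star> \<iota> A') = b \<cdot> \<lambda>\<^sub>u A'" .
  moreover have "arr g" "src g = A \<otimes> A'" "tgt g = Y \<otimes> L" by (simp_all add: g_def)
  ultimately show thesis using that by blast
qed

end

section \<open>Nonzero morphisms in pseudo-tensor categories\<close>

context pseudo_tensor_category
begin

lemma zero_Hom [simp]: "\<lbrakk>X \<in> Obj C; Y \<in> Obj C\<rbrakk> \<Longrightarrow> 0 \<in> Hom C X Y"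
  using Hom_subspace subspace_0 by blast

lemma Comp_zero_left: "\<lbrakk>X \<in> Obj C; Y \<in> Obj C; Z \<in> Obj C; f \<in> Hom C X Y\<rbrakk> \<Longrightarrow> 0 \<odot> f = 0"
  using Comp_add_left[of X Y Z f 0 0] by simp

lemma Comp_zero_right: "\<lbrakk>X \<in> Obj C; Y \<in> Obj C; Z \<in> Obj C; g \<in> Hom C Y Z\<rbrakk> \<Longrightarrow> g \<odot> 0 = 0"
  using Comp_add_right[of X Y Z 0 0 g] by simp

lemma TensM_zero_right: "\<lbrakk>X \<in> Obj C; X' \<in> Obj C; Y \<in> Obj C; Y' \<in> Obj C; f \<in> Hom C X X'\<rbrakk>
    \<Longrightarrow> f \<boxtimes> 0 = 0"
  using TensM_add_right[of X X' Y Y' f 0 0] by simp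

lemma TensM_zero_left: "\<lbrakk>X \<in> Obj C; X' \<in> Obj C; Y \<in> Obj C; Y' \<in> Obj C; g \<in> Hom C Y Y'\<rbrakk>
    \<Longrightarrow> 0 \<boxtimes> g = 0"
  using TensM_add_left[of X X' Y Y' 0 0 g] by simp

lemma cmp_nonzero:
  assumes "arr f" "arr g" "tgt f = src g" "mor (g \<cdot> f) \<noteq> 0"
  shows "mor f \<noteq> 0" "mor g \<noteq> 0"
  using assms Comp_zero_left[of "src f" "tgt f" "tgt g" "mor f"]
    Comp_zero_right[of "src f" "tgt f" "tgt g" "mor g"]
  by (auto simp: mor_cmp arr_def simp del: arr_obj)

lemma tns_nonzero:
  assumes "arr f" "arr g" "mor (f \<star> g) \<noteq> 0"
  shows "mor f \<noteq> 0" "mor g \<noteq> 0"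
  using assms TensM_zero_left[of "src f" "tgt f" "src g" "tgt g" "mor g"]
    TensM_zero_right[of "src f" "tgt f" "src g" "tgt g" "mor f"]
  by (auto simp: structure_arrow_mor arr_def simp del: arr_obj)

lemma iso_cmp_nonzero:
  assumes ab: "inverse_arrows a b" and f: "arr f" "tgt f = src a" "mor f \<noteq> 0"
  shows "mor (a \<cdot> f) \<noteq> 0"
proof -
  note d = inverse_arrowsD[OF ab]
  have "b \<cdot> (a \<cdot> f) = f"
    using cmp_assoc[OF f(1) d(1,2)] f d by simp
  then show ?thesis
    using cmp_nonzero(1)[of "a \<cdot> f" b] f d by simp
qed

lemma cmp_iso_nonzero:
  assumes ab: "inverse_arrows a b" and f: "arr f" "src f = tgt a" "mor f \<noteq> 0"
  shows "mor (f \<cdot> a) \<noteq> 0"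
proof -
  note d = inverse_arrowsD[OF ab]
  have "(f \<cdot> a) \<cdot> b = f"
    using cmp_assoc[OF d(2,1) f(1)] f d by simp
  then show ?thesis
    using cmp_nonzero(2)[of b "f \<cdot> a"] f d by simp
qed

lemma Hom_nonzero_arrow:
  assumes "X \<in> Obj C" "Y \<in> Obj C" "Hom C X Y \<noteq> {0}"
  obtains t where "arr t" "src t = X" "tgt t = Y" "mor t \<noteq> 0"
proof -
  obtain f where "f \<in> Hom C X Y" "f \<noteq> 0" using assms zero_Hom[of X Y] by blast
  then show thesis using that[of "(X, f, Y)"] assms by simp
qed

lemma arrow_Hom_nonzero: "\<lbrakk>arr t; mor t \<noteq> 0\<rbrakk> \<Longrightarrow> Hom C (src t) (tgt t) \<noteq> {0}"
  by (auto simp: arr_def simp del: arr_obj)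

lemma Hom_nonzero_iso:
  assumes "Hom C X Y \<noteq> {0}" "isomorphic C X X'" "isomorphic C Y Y'"
    "X \<in> Obj C" "X' \<in> Obj C" "Y \<in> Obj C" "Y' \<in> Obj C"
  shows "Hom C X' Y' \<noteq> {0}"
proof -
  obtain t where t: "arr t" "src t = X" "tgt t = Y" "mor t \<noteq> 0" using Hom_nonzero_arrow assms by metis
  obtain a b where a: "inverse_arrows a b" "src a = X'" "tgt a = X"
    using isomorphic_arrows[OF isomorphic_sym] assms by metis
  obtain c d where c: "inverse_arrows c d" "src c = Y" "tgt c = Y'"
    using isomorphic_arrows assms by metis
  have "mor (c \<cdot> t) \<noteq> 0" using iso_cmp_nonzero[OF c(1)] t c by simp
  then have "mor ((c \<cdot> t) \<cdot> a) \<noteq> 0"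
    using cmp_iso_nonzero[OF a(1)] t c a inverse_arrowsD[OF c(1)] by simp
  then show ?thesis
    using arrow_Hom_nonzero[of "(c \<cdot> t) \<cdot> a"] t c a inverse_arrowsD[OF c(1)] inverse_arrowsD[OF a(1)]
    by simp
qed

text \<open>
  By the zigzag identity, a vanishing coevaluation would force the invertible \<open>\<lambda>\<^sub>u Y\<close> to vanish.
\<close>

lemma coevaluation_nonzero:
  assumes dual: "duality_arrows L Y ev co" and Y0: "Id C Y \<noteq> 0"
  shows "mor co \<noteq> 0"
proof -
  have d [simp]: "L \<in> Obj C" "Y \<in> Obj C" "arr ev" "src ev = L \<otimes> Y" "tgt ev = \<one>"
      "arr co" "src co = \<one>" "tgt co = Y \<otimes> L"
    and z: "\<rho>\<^sub>u Y \<cdot> (\<iota> Y \<star> ev) \<cdot> \<alpha> Y L Y \<cdot> (co \<star> \<iota> Y) = \<lambda>\<^sub>u Y"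
    using dual by (simp_all add: duality_arrows_def)
  obtain b where b: "inverse_arrows (\<lambda>\<^sub>u Y) b" using lun_inverse[of Y] by auto
  note bd = inverse_arrowsD[OF b]
  have "mor (\<lambda>\<^sub>u Y \<cdot> b) \<noteq> 0" unfolding bd(6) using Y0 by (simp add: mor_ida)
  then have "mor (\<lambda>\<^sub>u Y) \<noteq> 0" using cmp_nonzero(2)[of b "\<lambda>\<^sub>u Y"] bd by simp
  then have "mor ((\<rho>\<^sub>u Y \<cdot> (\<iota> Y \<star> ev) \<cdot> \<alpha> Y L Y) \<cdot> (co \<star> \<iota> Y)) \<noteq> 0"
    by (simp add: cmp_assoc z)
  then have "mor (co \<star> \<iota> Y) \<noteq> 0"
    by (rule cmp_nonzero(1)[rotated 3]) simp_all
  then show ?thesis by (rule tns_nonzero(1)[rotated 2]) simp_all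
qed

lemma ldual_is_left_dual: "X \<in> Obj C \<Longrightarrow> is_left_dual C (ldual C X) X"
  unfolding ldual_def using left_dual_exists by (rule someI_ex)

lemma rdual_is_right_dual: "X \<in> Obj C \<Longrightarrow> is_left_dual C X (rdual C X)"
  unfolding rdual_def is_right_dual_def
  using right_dual_exists[unfolded is_right_dual_def] by (rule someI_ex)

lemma dual_Obj [simp]: "X \<in> Obj C \<Longrightarrow> ldual C X \<in> Obj C" "X \<in> Obj C \<Longrightarrow> rdual C X \<in> Obj C"
  using ldual_is_left_dual rdual_is_right_dual by (auto simp: is_left_dual_def)

lemma Hom_dim_zero:
  assumes "X \<in> Obj C" "Y \<in> Obj C" "dim (Hom C X Y) = 0"
  shows "Hom C X Y = {0}"
proof -
  obtain A where A: "finite A" "span A = Hom C X Y" using Hom_finite_dim assms by blast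
  obtain D where D: "D \<subseteq> Hom C X Y" "independent D" "Hom C X Y \<subseteq> span D" "card D = dim (Hom C X Y)"
    using basis_exists by blast
  have "finite D" using independent_span_bound[OF A(1) D(2)] D(1) A(2) by simp
  then have "D = {}" using D assms by simp
  then show ?thesis using D zero_Hom[OF assms(1,2)] by auto
qed

lemma Hom_dim_one:
  assumes "dim (Hom C X Y) = 1" "f \<in> Hom C X Y" "g \<in> Hom C X Y" "g \<noteq> 0"
  obtains c where "f = scale c g"
proof -
  obtain D where D: "D \<subseteq> Hom C X Y" "independent D" "Hom C X Y \<subseteq> span D" "card D = dim (Hom C X Y)"
    using basis_exists by blast
  then obtain h where "D = {h}" using assms by (metis card_1_singletonE)
  then have "f \<in> span {h}" "g \<in> span {h}" using D assms by auto
  then obtain r s where rs: "f = scale r h" "g = scale s h" by (auto simp: span_singleton)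
  then have "s \<noteq> 0" using assms by auto
  then have "f = scale (r / s) g" using rs by simp
  then show thesis using that by blast
qed

end

section \<open>Contravariant equivalences and shifts\<close>

context pseudo_tensor_category
begin

lemma opposite_isomorphic: "is_iso (opposite C) X Y f \<Longrightarrow> isomorphic C Y X"
  unfolding isomorphic_def is_iso_def inverse_pair_def opposite_def by auto

lemma contravariant_equivalence:
  assumes "monoidal_equivalence C (opposite C) Jo Jm"
  shows "X \<in> Obj C \<Longrightarrow> Jo X \<in> Obj C"
    and "\<lbrakk>X \<in> Obj C; Y \<in> Obj C; f \<in> Hom C X Y\<rbrakk> \<Longrightarrow> Jm f \<in> Hom C (Jo Y) (Jo X)"
    and "\<lbrakk>X \<in> Obj C; Y \<in> Obj C; Z \<in> Obj C; f \<in> Hom C X Y; g \<in> Hom C Y Z\<rbrakk>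
      \<Longrightarrow> Jm (g \<odot> f) = Jm f \<odot> Jm g"
    and "\<lbrakk>X \<in> Obj C; Y \<in> Obj C\<rbrakk> \<Longrightarrow> isomorphic C (Jo (X \<otimes> Y)) (Jo X \<otimes> Jo Y)"
    and "isomorphic C (Jo \<one>) \<one>"
proof -
  have F: "is_functor C (opposite C) Jo Jm"
    using assms unfolding monoidal_equivalence_def is_equivalence_def quasi_inverse_def by blast
  show "X \<in> Obj C \<Longrightarrow> Jo X \<in> Obj C"
    and "\<lbrakk>X \<in> Obj C; Y \<in> Obj C; f \<in> Hom C X Y\<rbrakk> \<Longrightarrow> Jm f \<in> Hom C (Jo Y) (Jo X)"
    and "\<lbrakk>X \<in> Obj C; Y \<in> Obj C; Z \<in> Obj C; f \<in> Hom C X Y; g \<in> Hom C Y Z\<rbrakk>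
      \<Longrightarrow> Jm (g \<odot> f) = Jm f \<odot> Jm g"
    using F unfolding is_functor_def opposite_def by auto
  obtain J u where J: "monoidal_structure C (opposite C) Jo Jm J u"
    using assms unfolding monoidal_equivalence_def by blast
  have "is_iso (opposite C) (Jo X \<otimes> Jo Y) (Jo (X \<otimes> Y)) (J X Y)" if "X \<in> Obj C" "Y \<in> Obj C"
    using J that unfolding monoidal_structure_def by (simp add: opposite_def)
  then show "\<lbrakk>X \<in> Obj C; Y \<in> Obj C\<rbrakk> \<Longrightarrow> isomorphic C (Jo (X \<otimes> Y)) (Jo X \<otimes> Jo Y)"
    by (rule opposite_isomorphic)
  have "is_iso (opposite C) \<one> (Jo \<one>) u"
    using J unfolding monoidal_structure_def by (simp add: opposite_def)
  then show "isomorphic C (Jo \<one>) \<one>" by (rule opposite_isomorphic)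
qed

lemma contravariant_equivalence_faithful:
  assumes I: "monoidal_equivalence C (opposite C) Jo Jm"
    and XY: "X \<in> Obj C" "Y \<in> Obj C" and f: "f \<in> Hom C X Y" and g: "g \<in> Hom C X Y"
    and eq: "Jm f = Jm g"
  shows "f = g"
proof -
  obtain Ko Km \<eta> where \<eta>: "natural_iso C C id id (Ko \<circ> Jo) (Km \<circ> Jm) \<eta>"
    and K: "is_functor (opposite C) C Ko Km"
    using I unfolding monoidal_equivalence_def is_equivalence_def quasi_inverse_def by blast
  have KY: "Ko (Jo Y) \<in> Obj C"
    using K contravariant_equivalence(1)[OF I XY(2)] unfolding is_functor_def opposite_def by simp
  have "is_iso C Y (Ko (Jo Y)) (\<eta> Y)" and "\<eta> Y \<odot> f = Km (Jm f) \<odot> \<eta> X" "\<eta> Y \<odot> g = Km (Jm g) \<odot> \<eta> X"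
    using \<eta> XY f g unfolding natural_iso_def by auto
  then have e: "\<eta> Y \<odot> f = \<eta> Y \<odot> g" using eq by simp
  obtain b where b: "inverse_arrows (Y, \<eta> Y, Ko (Jo Y)) b"
    using is_iso_inverse_arrow[OF \<open>is_iso C Y (Ko (Jo Y)) (\<eta> Y)\<close> XY(2) KY] by blast
  have "(X, f, Y) = (X, g, Y)"
    by (rule iso_cancel_left[OF b]) (use XY f g e in \<open>simp_all add: cmp_def\<close>)
  then show ?thesis by simp
qed

text \<open>
  The functor is not known to be additive, so that it might conceivably send a nonzero morphism to zero.
  But if \<open>f\<close> were sent to zero, then \<open>f\<close> and \<open>f \<odot> 0\<close> would have the same image, and faithfulness would
  give \<open>f = f \<odot> 0 = 0\<close>.
\<close>

lemma contravariant_equivalence_nonzero: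
  assumes I: "monoidal_equivalence C (opposite C) Jo Jm"
    and XY: "X \<in> Obj C" "Y \<in> Obj C" and f: "f \<in> Hom C X Y" "f \<noteq> 0"
  shows "Jm f \<noteq> 0"
proof
  assume 0: "Jm f = 0"
  note Jfun = contravariant_equivalence[OF I]
  have "Jm (f \<odot> 0) = Jm 0 \<odot> Jm f"
    using Jfun(3)[OF XY(1) XY(1) XY(2) zero_Hom f(1)] XY by simp
  also have "\<dots> = Jm f"
    using Comp_zero_right[of "Jo Y" "Jo X" "Jo X" "Jm 0"] Jfun(1) Jfun(2)[OF XY(1) XY(1) zero_Hom] XY
    by (simp add: 0)
  finally have "Jm (f \<odot> 0) = Jm f" .
  moreover have "f \<odot> 0 = 0" using Comp_zero_right[OF XY(1) XY(1) XY(2) f(1)] .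
  ultimately have "0 = f"
    using contravariant_equivalence_faithful[OF I XY zero_Hom f(1)] XY by simp
  then show False using f by simp
qed

lemma contravariant_Hom_nonzero:
  assumes I: "monoidal_equivalence C (opposite C) Jo Jm"
    and XY: "X \<in> Obj C" "Y \<in> Obj C" "Hom C X Y \<noteq> {0}"
  shows "Hom C (Jo Y) (Jo X) \<noteq> {0}"
proof -
  obtain f where "f \<in> Hom C X Y" "f \<noteq> 0" using XY zero_Hom[of X Y] by blast
  then show ?thesis
    using contravariant_equivalence(2)[OF I] contravariant_equivalence_nonzero[OF I] XY by blast
qed

text \<open>
  A shift can be moved from one tensor factor to the other by the bimodule structure, and there it
  meets its quasi-inverse.
\<close>

lemma shift_tensor_cancel:
  assumes F: "grading_shift C Fo Fm Go Gm" and X: "X \<in> Obj C" and Y: "Y \<in> Obj C"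
  shows "(Fo ^^ n) X \<in> Obj C \<and> (Go ^^ n) Y \<in> Obj C
    \<and> isomorphic C ((Fo ^^ n) X \<otimes> (Go ^^ n) Y) (X \<otimes> Y)"
proof (induction n)
  case 0
  then show ?case using X Y by (simp add: isomorphic_refl)
next
  case (Suc n)
  define P Q where "P = (Fo ^^ n) X" and "Q = (Go ^^ n) Y"
  have PQ: "P \<in> Obj C" "Q \<in> Obj C" "isomorphic C (P \<otimes> Q) (X \<otimes> Y)"
    using Suc by (simp_all add: P_def Q_def)
  have Fo: "A \<in> Obj C \<Longrightarrow> Fo A \<in> Obj C" and Go: "A \<in> Obj C \<Longrightarrow> Go A \<in> Obj C" for A
    using F unfolding grading_shift_def quasi_inverse_def is_functor_def by auto
  obtain \<epsilon> where "natural_iso C C (Fo \<circ> Go) (Fm \<circ> Gm) id id \<epsilon>"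
    using F unfolding grading_shift_def quasi_inverse_def by blast
  then have FG: "isomorphic C (Fo (Go Q)) Q"
    using PQ unfolding natural_iso_def isomorphic_def by auto
  obtain s t where st: "bimodule_structure C Fo Fm s t"
    using F unfolding grading_shift_def by blast
  have "isomorphic C (Fo (P \<otimes> Go Q)) (P \<otimes> Fo (Go Q))"
    using st PQ Go unfolding bimodule_structure_def left_module_structure_def isomorphic_def by blast
  moreover have "isomorphic C (Fo P \<otimes> Go Q) (Fo (P \<otimes> Go Q))"
    using st PQ Go
    unfolding bimodule_structure_def right_module_structure_def isomorphic_def is_iso_def inverse_pair_def
    by blast
  moreover have "isomorphic C (P \<otimes> Fo (Go Q)) (P \<otimes> Q)"
    using isomorphic_TensO isomorphic_refl FG PQ Fo Go by simp
  ultimately have "isomorphic C (Fo P \<otimes> Go Q) (X \<otimes> Y)"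
    using PQ Fo Go X Y
    by (meson isomorphic_trans TensO_Obj)
  then show ?case using PQ Fo Go by (simp add: P_def Q_def)
qed

end

section \<open>Orthonormal families closed under duals\<close>

text \<open>
  Such a family satisfies Schur's lemma: nonzero morphisms between members are scalar multiples of
  identities. A member is therefore recognised by a single nonzero morphism, and this is how the duals
  are identified.
\<close>

locale orthonormal_family = pseudo_tensor_category C scale
  for C :: "('o, 'm::ab_group_add) moncat" (structure) and scale :: "'k::field \<Rightarrow> 'm \<Rightarrow> 'm" +
  fixes W :: "'w set" and B :: "'w \<Rightarrow> 'o"
  assumes B_Obj [simp]: "x \<in> W \<Longrightarrow> B x \<in> Obj C"
    and dim_Hom_B: "\<lbrakk>x \<in> W; y \<in> W\<rbrakk> \<Longrightarrow> dim (Hom C (B x) (B y)) = (if x = y then 1 else 0)"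
    and ldual_B: "x \<in> W \<Longrightarrow> \<exists>y\<in>W. isomorphic C (ldual C (B x)) (B y)"
    and rdual_B: "x \<in> W \<Longrightarrow> \<exists>y\<in>W. isomorphic C (rdual C (B x)) (B y)"
begin

lemma Hom_B_nonzero: "\<lbrakk>x \<in> W; y \<in> W; Hom C (B x) (B y) \<noteq> {0}\<rbrakk> \<Longrightarrow> x = y"
  using Hom_dim_zero[of "B x" "B y"] dim_Hom_B by (metis B_Obj)

lemma Id_B_nonzero:
  assumes "x \<in> W"
  shows "Id C (B x) \<noteq> 0"
proof
  assume 0: "Id C (B x) = 0"
  have "Hom C (B x) (B x) \<subseteq> {0}"
    using Comp_Id[of "B x" "B x"] Comp_zero_right[of "B x" "B x" "B x"] assms 0 by auto
  then have "dim (Hom C (B x) (B x)) = dim {0}"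
    using zero_Hom[of "B x" "B x"] assms by (metis B_Obj empty_iff subset_singletonD)
  also have "\<dots> = 0" by (rule dim_unique[of "{}"]) (simp_all add: independent_empty)
  finally show False using dim_Hom_B assms by simp
qed

lemma isomorphic_B: "\<lbrakk>x \<in> W; y \<in> W; isomorphic C (B x) (B y)\<rbrakk> \<Longrightarrow> x = y"
proof -
  assume xy: "x \<in> W" "y \<in> W" "isomorphic C (B x) (B y)"
  have "Hom C (B x) (B x) \<noteq> {0}"
    using Id_B_nonzero[OF xy(1)] Id_in_Hom[of "B x"] xy(1) by auto
  then have "Hom C (B x) (B y) \<noteq> {0}"
    using Hom_nonzero_iso[OF _ isomorphic_refl xy(3)] xy by simp
  then show ?thesis using Hom_B_nonzero xy by blast
qed

text \<open>
  Composed with an isomorphism between \<open>L\<close> and \<open>B w\<close>, the arrow \<open>\<phi>\<close> is a nonzero morphism between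
  members of the family, hence a nonzero multiple of an identity.
\<close>

lemma nonzero_arrow_iso:
  assumes w: "w \<in> W" "isomorphic C L (B w)" and L: "L \<in> Obj C" and z: "z \<in> W"
    and \<phi>: "arr \<phi>" "src \<phi> = L" "tgt \<phi> = B z" "mor \<phi> \<noteq> 0"
  obtains \<psi> where "inverse_arrows \<phi> \<psi>"
proof -
  obtain a b where ab: "inverse_arrows a b" and a: "src a = L" "tgt a = B w"
    using isomorphic_arrows[OF w(2) L B_Obj[OF w(1)]] by blast
  note d = inverse_arrowsD[OF ab]
  have nz: "mor (\<phi> \<cdot> b) \<noteq> 0"
  proof -
    have "inverse_arrows b a" using d by (simp add: inverse_arrows_def)
    then show ?thesis using cmp_iso_nonzero[of b a \<phi>] \<phi> d a by simp
  qed
  have \<phi>b: "arr (\<phi> \<cdot> b)" "src (\<phi> \<cdot> b) = B w" "tgt (\<phi> \<cdot> b) = B z"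
    using \<phi> d a by simp_all
  have wz: "w = z" using arrow_Hom_nonzero[OF \<phi>b(1) nz] \<phi>b Hom_B_nonzero w z by simp
  have in_H: "mor (\<phi> \<cdot> b) \<in> Hom C (B z) (B z)" using \<phi>b wz by (simp add: arr_def del: arr_obj)
  obtain c where c: "mor (\<phi> \<cdot> b) = scale c (Id C (B z))"
    using Hom_dim_one[OF _ in_H _ Id_B_nonzero[OF z]] dim_Hom_B z Id_in_Hom by auto
  have "c \<noteq> 0" using c nz by auto
  define k where "k = (B z, scale (1 / c) (Id C (B z)), B z)"
  have sc: "scale e (Id C (B z)) \<in> Hom C (B z) (B z)" for e
    using Hom_subspace[of "B z" "B z"] subspace_scale Id_in_Hom[of "B z"] z by simp
  have k: "arr k" "src k = B z" "tgt k = B z" using z sc by (simp_all add: k_def)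
  have sc2: "scale e (Id C (B z)) \<odot> scale e' (Id C (B z)) = scale (e * e') (Id C (B z))" for e e'
    using Comp_scale_left[of "B z" "B z" "B z" "scale e' (Id C (B z))" "Id C (B z)" e]
      Id_Comp[of "B z" "B z"] Id_in_Hom[of "B z"] sc z by simp
  have "mor (k \<cdot> (\<phi> \<cdot> b)) = Id C (B z)" "mor ((\<phi> \<cdot> b) \<cdot> k) = Id C (B z)"
    using \<open>c \<noteq> 0\<close> unfolding mor_cmp[of k] mor_cmp[of "\<phi> \<cdot> b"] c by (simp_all add: k_def sc2)
  then have "k \<cdot> (\<phi> \<cdot> b) = \<iota> (B z)" "(\<phi> \<cdot> b) \<cdot> k = \<iota> (B z)"
    using \<phi>b k wz by (auto intro!: arrow_eqI simp: mor_ida)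
  then have "inverse_arrows (\<phi> \<cdot> b) k"
    using \<phi>b k wz by (simp add: inverse_arrows_def)
  then have "inverse_arrows ((\<phi> \<cdot> b) \<cdot> a) (b \<cdot> k)"
    using inverse_arrows_cmp[OF ab] a \<phi>b by simp
  moreover have "(\<phi> \<cdot> b) \<cdot> a = \<phi>" using \<phi> d a by (simp add: cmp_assoc)
  ultimately show thesis using that by simp
qed

text \<open>
  The morphism \<open>\<phi>\<close> through which \<open>u\<close> factors is nonzero together with \<open>u\<close>, hence invertible. Thus \<open>u\<close> is
  itself a coevaluation of \<open>B x\<close>, once the dual is identified with \<open>B z\<close> along \<open>\<phi>\<close>.
\<close>

lemma unit_map_tensor:
  assumes x: "x \<in> W" and z: "z \<in> W"
    and dual: "duality_arrows L (B x) ev co" and w: "w \<in> W" "isomorphic C L (B w)"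
    and u: "arr u" "src u = \<one>" "tgt u = B x \<otimes> B z" "mor u \<noteq> 0"
  obtains \<phi> \<psi> where "inverse_arrows \<phi> \<psi>" "src \<phi> = L" "tgt \<phi> = B z" "(\<iota> (B x) \<star> \<phi>) \<cdot> co = u"
proof -
  have d: "L \<in> Obj C" "B x \<in> Obj C" "arr co" "src co = \<one>" "tgt co = B x \<otimes> L"
    using dual by (simp_all add: duality_arrows_def)
  obtain \<phi> where \<phi>: "arr \<phi>" "src \<phi> = L" "tgt \<phi> = B z" "(\<iota> (B x) \<star> \<phi>) \<cdot> co = u"
    using zigzag_factor[OF dual B_Obj[OF z] u(1-3)] by blast
  have "mor (\<iota> (B x) \<star> \<phi>) \<noteq> 0"
    using cmp_nonzero(2)[of co "\<iota> (B x) \<star> \<phi>"] \<phi> u d by simp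
  then have "mor \<phi> \<noteq> 0" using tns_nonzero(2)[of "\<iota> (B x)" \<phi>] \<phi> d by simp
  then obtain \<psi> where "inverse_arrows \<phi> \<psi>"
    using nonzero_arrow_iso[OF w d(1) z \<phi>(1-3)] by blast
  then show thesis using that \<phi> by blast
qed

lemma Hom_unit_tensor_ldual:
  assumes x: "x \<in> W" and z: "z \<in> W" and H: "Hom C \<one> (B x \<otimes> B z) \<noteq> {0}"
  shows "isomorphic C (ldual C (B x)) (B z)"
proof -
  obtain ev co where d: "duality_arrows (ldual C (B x)) (B x) ev co"
    using left_dual_arrows[OF ldual_is_left_dual] x by (metis B_Obj)
  obtain w where w: "w \<in> W" "isomorphic C (ldual C (B x)) (B w)" using ldual_B x by blast
  obtain u where u: "arr u" "src u = \<one>" "tgt u = B x \<otimes> B z" "mor u \<noteq> 0"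
    using Hom_nonzero_arrow[OF _ _ H] x z by auto
  obtain \<phi> \<psi> where "inverse_arrows \<phi> \<psi>" "src \<phi> = ldual C (B x)" "tgt \<phi> = B z"
    using unit_map_tensor[OF x z d w u] by blast
  then show ?thesis using inverse_arrows_isomorphic by metis
qed

text \<open>
  The coevaluation of a dual pair is a nonzero morphism \<open>\<one> \<rightarrow> X \<otimes> L\<close>, so \<open>Hom_unit_tensor_ldual\<close>
  recognises \<open>L\<close> as the dual of \<open>B x\<close>. Right duals are covered too, because \<open>X\<close> is a left dual of
  its right dual.
\<close>

lemma ldual_pair:
  assumes X: "X \<in> Obj C" "isomorphic C X (B x)" "x \<in> W" and L: "L \<in> Obj C" "isomorphic C L (B z)" "z \<in> W"
    and LX: "is_left_dual C L X"
  shows "isomorphic C (ldual C (B x)) (B z)"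
proof -
  obtain ev co where d: "duality_arrows L X ev co" using left_dual_arrows[OF LX] by blast
  have co: "arr co" "src co = \<one>" "tgt co = X \<otimes> L" using d by (simp_all add: duality_arrows_def)
  have "Hom C (B x) (B x) \<noteq> {0}"
    using Id_B_nonzero[OF X(3)] Id_in_Hom[of "B x"] X(3) by auto
  then have "Hom C X X \<noteq> {0}"
    using Hom_nonzero_iso[OF _ isomorphic_sym isomorphic_sym] X by (metis B_Obj)
  then have "Id C X \<noteq> 0"
    using Comp_Id[of X X] Comp_zero_right[of X X X] X zero_Hom[of X X] by force
  then have "Hom C \<one> (X \<otimes> L) \<noteq> {0}"
    using coevaluation_nonzero[OF d] arrow_Hom_nonzero[OF co(1)] co by simp
  then have "Hom C \<one> (B x \<otimes> B z) \<noteq> {0}"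
    using Hom_nonzero_iso[OF _ isomorphic_refl isomorphic_TensO] X L by simp
  then show ?thesis using Hom_unit_tensor_ldual X L by blast
qed

text \<open>
  The heart of the argument. Write \<open>X = B y \<otimes> B z\<close> and let \<open>u = a \<odot> f\<close>. It is nonzero, hence a
  coevaluation after identifying \<open>B z\<close> with the dual \<open>L\<close> of \<open>B y\<close>, and so the unit of the algebra \<open>Y \<otimes> L\<close>
  factors through \<open>A\<close>. The contravariant equivalence fixes \<open>X\<close> up to isomorphism; it turns \<open>p\<close> into a
  morphism from the image of \<open>A\<close> to \<open>X\<close>, and \<open>u\<close> into a linear form on \<open>X\<close> whose restriction along the
  former is the image of \<open>p \<odot> u = f\<close>. Multiplying in the algebra and applying this form is thus a
  pairing that does not vanish against \<open>f\<close>.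
\<close>

lemma retract_pairing_nonzero:
  assumes I: "monoidal_equivalence C (opposite C) Jo Jm" and IB: "\<And>x. x \<in> W \<Longrightarrow> Jo (B x) = B x"
    and y: "y \<in> W" and z: "z \<in> W" and A: "A \<in> Obj C"
    and a: "a \<in> Hom C A (B y \<otimes> B z)" and p: "p \<in> Hom C (B y \<otimes> B z) A" and pa: "p \<odot> a = Id C A"
    and f: "f \<in> Hom C \<one> A" "f \<noteq> 0"
  shows "Hom C (A \<otimes> Jo A) \<one> \<noteq> {0}"
proof -
  note Jfun = contravariant_equivalence[OF I]
  define Y Z where "Y = B y" and "Z = B z"
  have YZ [simp]: "Y \<in> Obj C" "Z \<in> Obj C" "A \<in> Obj C" using y z A by (simp_all add: Y_def Z_def)
  define L where "L = ldual C Y"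
  have L [simp]: "L \<in> Obj C" by (simp add: L_def)
  obtain ev co where d: "duality_arrows L Y ev co"
    using left_dual_arrows[OF ldual_is_left_dual] by (metis L_def YZ(1))
  obtain w where w: "w \<in> W" "isomorphic C L (B w)" using ldual_B y by (auto simp: L_def Y_def)
  define u where "u = a \<odot> f"
  have af: "a \<in> Hom C A (Y \<otimes> Z)" "p \<in> Hom C (Y \<otimes> Z) A" using a p by (simp_all add: Y_def Z_def)
  have uH: "u \<in> Hom C \<one> (Y \<otimes> Z)"
    unfolding u_def using Comp_in_Hom[of \<one> A "Y \<otimes> Z"] af f by simp
  have pu: "p \<odot> u = f"
    unfolding u_def using Comp_assoc[of \<one> A "Y \<otimes> Z" A f a p] Id_Comp[of \<one> A f] pa af f by simp
  have "u \<noteq> 0" using pu f Comp_zero_right[of \<one> "Y \<otimes> Z" A p] af by auto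
  then have ua: "arr (\<one>, u, Y \<otimes> Z)" "src (\<one>, u, Y \<otimes> Z) = \<one>" "tgt (\<one>, u, Y \<otimes> Z) = B y \<otimes> B z"
      "mor (\<one>, u, Y \<otimes> Z) \<noteq> 0"
    using uH y z by (simp_all add: Y_def Z_def)
  obtain \<phi> \<psi> where \<phi>\<psi>: "inverse_arrows \<phi> \<psi>" and \<phi>: "src \<phi> = L" "tgt \<phi> = Z"
      "(\<iota> Y \<star> \<phi>) \<cdot> co = (\<one>, u, Y \<otimes> Z)"
    using unit_map_tensor[OF y z d[unfolded Y_def] w ua] unfolding Y_def Z_def by blast
  have \<Phi>: "inverse_arrows (\<iota> Y \<star> \<phi>) (\<iota> Y \<star> \<psi>)"
    using inverse_arrows_whisker_left[OF \<phi>\<psi>] by simp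
  note \<Phi>d = inverse_arrowsD[OF \<Phi>] and \<phi>d = inverse_arrowsD[OF \<phi>\<psi>]
  have \<Psi>: "inverse_arrows (\<iota> Y \<star> \<psi>) (\<iota> Y \<star> \<phi>)" using \<Phi>d by (simp add: inverse_arrows_def)
  have [simp]: "arr co" "src co = \<one>" "tgt co = Y \<otimes> L" using d by (simp_all add: duality_arrows_def)
  have [simp]: "arr (\<iota> Y \<star> \<psi>)" "src \<psi> = Z" "tgt \<psi> = L" "arr (\<iota> Y \<star> \<phi>)" "src \<phi> = L" "tgt \<phi> = Z"
    using \<Phi>d \<phi>d \<phi> by simp_all

  \<comment> \<open>The unit of the algebra, factored through \<open>A\<close>.\<close>
  define fa where "fa = (\<one>, f, A)"
  define \<alpha>a where "\<alpha>a = (\<iota> Y \<star> \<psi>) \<cdot> (A, a, Y \<otimes> Z)"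
  have fa [simp]: "arr fa" "src fa = \<one>" "tgt fa = A" using f by (simp_all add: fa_def)
  have \<alpha>a: "arr \<alpha>a" "src \<alpha>a = A" "tgt \<alpha>a = Y \<otimes> L" using af by (simp_all add: \<alpha>a_def)
  have "(A, a, Y \<otimes> Z) \<cdot> fa = (\<one>, u, Y \<otimes> Z)" by (simp add: cmp_def u_def fa_def)
  then have \<alpha>f: "\<alpha>a \<cdot> fa = co"
    using af \<Phi>d by (simp add: \<alpha>a_def cmp_assoc \<phi>(3)[symmetric])
      (simp add: cmp_assoc[symmetric])

  have Iobj [simp]: "Jo A \<in> Obj C" "Jo \<one> \<in> Obj C" "Jo (Y \<otimes> Z) \<in> Obj C"
    using Jfun(1) by simp_all
  \<comment> \<open>The images of \<open>p\<close> and \<open>u\<close>, with reversed direction.\<close>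
  define \<beta>0 where "\<beta>0 = (Jo A, Jm p, Jo (Y \<otimes> Z))"
  define v0 where "v0 = (Jo (Y \<otimes> Z), Jm u, Jo \<one>)"
  have \<beta>0 [simp]: "arr \<beta>0" "src \<beta>0 = Jo A" "tgt \<beta>0 = Jo (Y \<otimes> Z)"
    using Jfun(2)[of "Y \<otimes> Z" A p] af by (simp_all add: \<beta>0_def)
  have v0 [simp]: "arr v0" "src v0 = Jo (Y \<otimes> Z)" "tgt v0 = Jo \<one>"
    using Jfun(2)[of \<one> "Y \<otimes> Z" u] uH by (simp_all add: v0_def)
  have "mor (v0 \<cdot> \<beta>0) = Jm f"
    using Jfun(3)[of \<one> "Y \<otimes> Z" A u p] uH af pu by (simp add: mor_cmp v0_def \<beta>0_def)
  then have nz: "mor (v0 \<cdot> \<beta>0) \<noteq> 0"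
    using contravariant_equivalence_nonzero[OF I _ _ f] by simp
  have "isomorphic C (Jo (Y \<otimes> Z)) (Y \<otimes> Z)"
    using Jfun(4)[of Y Z] IB y z by (simp add: Y_def Z_def)
  then obtain j k where jk: "inverse_arrows j k" and [simp]: "src j = Jo (Y \<otimes> Z)" "tgt j = Y \<otimes> Z"
    using isomorphic_arrows by (metis Iobj(3) TensO_Obj YZ(1,2))
  note jd = inverse_arrowsD[OF jk]
  have h: "inverse_arrows ((\<iota> Y \<star> \<psi>) \<cdot> j) (k \<cdot> (\<iota> Y \<star> \<phi>))"
    using inverse_arrows_cmp[OF jk \<Psi>] by simp
  \<comment> \<open>Both are transported to \<open>Y \<otimes> L\<close> along \<open>h\<close>.\<close>
  define \<beta> where "\<beta> = ((\<iota> Y \<star> \<psi>) \<cdot> j) \<cdot> \<beta>0"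
  define v where "v = v0 \<cdot> (k \<cdot> (\<iota> Y \<star> \<phi>))"
  have \<beta> [simp]: "arr \<beta>" "src \<beta> = Jo A" "tgt \<beta> = Y \<otimes> L" using jd by (simp_all add: \<beta>_def)
  have v [simp]: "arr v" "src v = Y \<otimes> L" "tgt v = Jo \<one>" using jd by (simp_all add: v_def)
  have "v \<cdot> \<beta> = v0 \<cdot> ((k \<cdot> (\<iota> Y \<star> \<phi>)) \<cdot> ((\<iota> Y \<star> \<psi>) \<cdot> j)) \<cdot> \<beta>0"
    using jd by (simp add: v_def \<beta>_def cmp_assoc)
  also have "\<dots> = v0 \<cdot> \<beta>0"
    unfolding inverse_arrowsD(5)[OF h] by simp
  finally have v\<beta>: "mor (v \<cdot> \<beta>) \<noteq> 0" using nz by simp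

  obtain g where g [simp]: "arr g" "src g = A \<otimes> Jo A" "tgt g = Y \<otimes> L"
    and gf: "g \<cdot> (fa \<star> \<iota> (Jo A)) = \<beta> \<cdot> \<lambda>\<^sub>u (Jo A)"
    using duality_pairing[OF d \<alpha>a fa \<alpha>f \<beta>] by blast
  obtain l where l: "inverse_arrows (\<lambda>\<^sub>u (Jo A)) l" using lun_inverse[of "Jo A"] by auto
  have "(v \<cdot> g) \<cdot> (fa \<star> \<iota> (Jo A)) = (v \<cdot> \<beta>) \<cdot> \<lambda>\<^sub>u (Jo A)"
    by (simp add: cmp_assoc gf)
  then have "mor ((v \<cdot> g) \<cdot> (fa \<star> \<iota> (Jo A))) \<noteq> 0"
    using cmp_iso_nonzero[OF l, of "v \<cdot> \<beta>"] v\<beta> by simp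
  then have "mor (v \<cdot> g) \<noteq> 0"
    using cmp_nonzero(2)[of "fa \<star> \<iota> (Jo A)" "v \<cdot> g"] by simp
  then have "Hom C (A \<otimes> Jo A) (Jo \<one>) \<noteq> {0}"
    using arrow_Hom_nonzero[of "v \<cdot> g"] by simp
  then show ?thesis
    using Hom_nonzero_iso[OF _ isomorphic_refl Jfun(5)] by simp
qed

end

section \<open>Property P6\<close>

text \<open>
  A supremum of integers that is a natural number is attained, and so is a finite infimum in \<open>enat\<close>.
  Hence the common value \<open>n\<close> of \<open>a\<close> and \<open>\<Delta>\<close> yields a single shift of \<open>B d\<close> that both receives a
  nonzero morphism from the unit and is a summand of some \<open>B y \<otimes> B z\<close>.
\<close>

lemma D_set_summand:
  assumes "d \<in> D_set C Fo Go W B"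
  obtains n y z where "d \<in> W" "Hom C \<one>\<^bsub>C\<^esub> ((Fo ^^ n) (B d)) \<noteq> {0}" "y \<in> W" "z \<in> W"
    "direct_summand C ((Fo ^^ n) (B d)) (B y \<otimes>\<^bsub>C\<^esub> B z)"
proof -
  let ?H = "{enat i | i. Hom C \<one>\<^bsub>C\<^esub> (shift Fo Go (int i) (B d)) \<noteq> {0}}"
  let ?A = "{ereal (of_int i) | i.
       \<exists>y\<in>W. \<exists>z\<in>W. direct_summand C (shift Fo Go i (B d)) (B y \<otimes>\<^bsub>C\<^esub> B z)}"
  have d: "d \<in> W" "Sup ?A = ereal_of_enat (Inf ?H)" "Inf ?H < \<infinity>"
    using assms unfolding D_set_def a_fun_def Delta_fun_def by auto
  have "?H \<noteq> {}"
  proof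
    assume "?H = {}"
    then have "Inf ?H = \<infinity>" by (simp only: Inf_enat_def) simp
    then show False using d(3) by simp
  qed
  then have "Inf ?H \<in> ?H" by (metis (lifting) Inf_enat_def LeastI ex_in_conv)
  then obtain n where n: "Inf ?H = enat n" "Hom C \<one>\<^bsub>C\<^esub> (shift Fo Go (int n) (B d)) \<noteq> {0}" by auto
  have S: "Sup ?A = ereal (real n)" using d(2) n(1) by simp
  have "ereal (real n - 1) < Sup ?A" by (simp add: S)
  then obtain r where r: "r \<in> ?A" "ereal (real n - 1) < r"
    unfolding less_Sup_iff by blast
  then obtain i where i: "r = ereal (of_int i)"
      "\<exists>y\<in>W. \<exists>z\<in>W. direct_summand C (shift Fo Go i (B d)) (B y \<otimes>\<^bsub>C\<^esub> B z)"
    by blast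
  have "ereal (of_int i) \<le> ereal (real n)" using Sup_upper[OF r(1)] S i(1) by simp
  then have "i = int n" using r(2) i(1) by simp
  then obtain y z where "y \<in> W" "z \<in> W" "direct_summand C (shift Fo Go (int n) (B d)) (B y \<otimes>\<^bsub>C\<^esub> B z)"
    using i(2) by auto
  then show thesis using that d n by (simp add: shift_def)
qed

theorem theoremA3p2:
  fixes S :: "('o, 'm::ab_group_add) moncat"
    and scale :: "'k::field \<Rightarrow> 'm \<Rightarrow> 'm"
    and Fo Go Io :: "'o \<Rightarrow> 'o" and Fm Gm Im :: "'m \<Rightarrow> 'm"
    and W :: "'w set" and B :: "'w \<Rightarrow> 'o" and d :: 'w
  assumes "pseudo_tensor_category S scale"
    and "grading_shift S Fo Fm Go Gm"
    and "\<forall>x\<in>W. indecomposable S (B x)"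
    and "\<forall>x\<in>W. (\<exists>y\<in>W. isomorphic S (ldual S (B x)) (B y)) \<and>
                (\<exists>y\<in>W. isomorphic S (rdual S (B x)) (B y))"
    and "\<forall>X. indecomposable S X \<longrightarrow>
           (\<exists>!(x, i). x \<in> W \<and> isomorphic S X (shift Fo Go i (B x)))"
    and "\<forall>x\<in>W. \<forall>y\<in>W. \<forall>i\<le>0.
           vector_space.dim scale (Hom S (B x) (shift Fo Go i (B y)))
             = (if x = y \<and> i = 0 then 1 else 0)"
    and "\<forall>X\<in>Obj S. isomorphic S (ldual S (ldual S X)) X"
    and "monoidal_equivalence S (opposite S) Io Im"
    and "\<forall>x\<in>W. Io (B x) = B x"
    and "\<forall>X\<in>Obj S. Io (shift Fo Go 1 X) = shift Fo Go (- 1) (Io X)"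
    and "d \<in> D_set S Fo Go W B"
  shows "d = lstar S W B d \<and> d = rstar S W B d"
proof -
  interpret pseudo_tensor_category S scale by (rule assms(1))
  have B_Obj: "B x \<in> Obj S" if "x \<in> W" for x
    using assms(3) that by (auto simp: indecomposable_def)
  interpret orthonormal_family S scale W B
  proof
    show "dim (Hom S (B x) (B y)) = (if x = y then 1 else 0)" if "x \<in> W" "y \<in> W" for x y
      using assms(6)[rule_format, OF that, of 0] by (simp add: shift_def)
  qed (use assms(4) B_Obj in auto)
  note I = assms(8)
  have IB: "Io (B x) = B x" if "x \<in> W" for x using assms(9) that by blast

  obtain n y z where d: "d \<in> W" and H: "Hom S \<one>\<^bsub>S\<^esub> ((Fo ^^ n) (B d)) \<noteq> {0}" and yz: "y \<in> W" "z \<in> W"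
    and summand: "direct_summand S ((Fo ^^ n) (B d)) (B y \<otimes>\<^bsub>S\<^esub> B z)"
    using D_set_summand[OF assms(11)] by blast
  define A where "A = (Fo ^^ n) (B d)"
  note cancel = shift_tensor_cancel[OF assms(2) B_Obj[OF d] B_Obj[OF d]]
  have A: "A \<in> Obj S" using cancel[of n] by (simp add: A_def)
  have "Io ((Fo ^^ m) (B d)) = (Go ^^ m) (B d)" for m
  proof (induction m)
    case 0
    then show ?case using IB d by simp
  next
    case (Suc m)
    then show ?case using assms(10) cancel[of m] by (simp add: shift_def)
  qed
  then have IA: "Io A = (Go ^^ n) (B d)" by (simp add: A_def)
  obtain a p where ap: "a \<in> Hom S A (B y \<otimes>\<^bsub>S\<^esub> B z)" "p \<in> Hom S (B y \<otimes>\<^bsub>S\<^esub> B z) A" "p \<odot>\<^bsub>S\<^esub> a = Id S A"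
    using summand unfolding direct_summand_def biproduct_def A_def by blast
  obtain f where f: "f \<in> Hom S \<one>\<^bsub>S\<^esub> A" "f \<noteq> 0"
    using H zero_Hom[of "\<one>\<^bsub>S\<^esub>" A] A by (auto simp: A_def)
  \<comment> \<open>The shifts of \<open>A\<close> and of its image are opposite and cancel in the tensor product.\<close>
  have "Hom S (A \<otimes>\<^bsub>S\<^esub> Io A) \<one>\<^bsub>S\<^esub> \<noteq> {0}"
    by (rule retract_pairing_nonzero[OF I IB yz A ap f])
  then have "Hom S (B d \<otimes>\<^bsub>S\<^esub> B d) \<one>\<^bsub>S\<^esub> \<noteq> {0}"
    using Hom_nonzero_iso[OF _ _ isomorphic_refl] cancel[of n] A B_Obj[OF d]
    by (auto simp: A_def IA[unfolded A_def])
  then have "Hom S (Io \<one>\<^bsub>S\<^esub>) (Io (B d \<otimes>\<^bsub>S\<^esub> B d)) \<noteq> {0}"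
    using contravariant_Hom_nonzero[OF I] B_Obj[OF d] by simp
  moreover have "isomorphic S (Io (B d \<otimes>\<^bsub>S\<^esub> B d)) (B d \<otimes>\<^bsub>S\<^esub> B d)"
    using contravariant_equivalence(4)[OF I, of "B d" "B d"] IB d B_Obj by simp
  ultimately have "Hom S \<one>\<^bsub>S\<^esub> (B d \<otimes>\<^bsub>S\<^esub> B d) \<noteq> {0}"
    using Hom_nonzero_iso[OF _ contravariant_equivalence(5)[OF I]]
      contravariant_equivalence(1)[OF I] B_Obj[OF d] by simp
  then have dd: "isomorphic S (ldual S (B d)) (B d)"
    using Hom_unit_tensor_ldual d by blast
  have unique: "y = z"
    if "isomorphic S X (B y)" "isomorphic S X (B z)" "y \<in> W" "z \<in> W" "X \<in> Obj S" for X y z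
    using isomorphic_B isomorphic_trans[OF isomorphic_sym] that B_Obj by metis
  have l: "lstar S W B d = d"
    unfolding lstar_def
    by (rule the_equality) (use unique[OF _ dd] d dd B_Obj in auto)

  \<comment> \<open>\<open>B d\<close> is the left dual of \<open>B w\<close>; by \<open>X\<^sup>*\<^sup>* \<simeq> X\<close>, dualising once more
    makes \<open>B w\<close> the left dual of \<open>B d\<close>.\<close>
  obtain w where w: "w \<in> W" "isomorphic S (rdual S (B d)) (B w)" using rdual_B d by blast
  have "isomorphic S (ldual S (B w)) (B d)"
    using ldual_pair[OF _ w(2,1) _ isomorphic_refl d rdual_is_right_dual] B_Obj[OF d] by simp
  then have "isomorphic S (ldual S (B d)) (B w)"
    using ldual_pair[OF _ _ d _ _ w(1) ldual_is_left_dual, of "ldual S (B w)"] assms(7) B_Obj[OF w(1)]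
    by simp
  then have "w = d" using unique[OF _ dd] w d B_Obj by simp
  then have "rstar S W B d = d"
    unfolding rstar_def
    by (intro the_equality) (use unique w d B_Obj in auto)
  then show ?thesis using l by simp
qed

end
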